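(* Let $W^{\sqrt{2}}=\bigcup_{j\in\mathbb{Z}}W^{\sqrt{2}}_j\subset V_{\sqrt{2}\,\mathbb{Z}}\simeq L_{(0,1)}$, where $W_j^{\sqrt2}=\mathbb{C}[e_i\mid i\in\mathbb{Z}]\,|j\sqrt{2}\rangle$. Then $W^{\sqrt{2}}$ is invariant under the action of $\widehat{\mathfrak{sl}_2}'$. In particular, $W^{\sqrt{2}}=V_{\sqrt{2}\,\mathbb{Z}}\simeq L_{(0,1)}$.
   Context: **Lattice vertex algebra.** The Heisenberg Lie algebra is $\mathfrak{H}=\langle C, a_n \mid n\in\mathbb{Z}\rangle_{\mathbb{C}}$ with $[a_n,a_m]=n\,\delta_{n+m,0}\,C$ and $C$ central. $F_\mu$ is the Fock module with highest weight vector $|\mu\rangle$: $C$ acts by $1$, $a_0|\mu\rangle=\mu|\mu\rangle$, $a_n|\mu\rangle=0$ for $n>0$, and $F_\mu$ is freely generated from $|\mu\rangle$ by the $a_{n}$, $n<0$. $V_{\sqrt{2}\,\mathbb{Z}}=\bigoplus_{\mu\in\sqrt{2}\,\mathbb{Z}}F_\mu$, with vertex operators $$V_\mu(z)=e^{\mu q}\,z^{\mu a_0}\exp\Big(-\mu\sum_{n<0}\frac{a_n}{n}z^{-n}\Big)\exp\Big(-\mu\sum_{n>0}\frac{a_n}{n}z^{-n}\Big),$$ where $[a_0,q]=1$, $[a_n,q]=0$ for $n\neq0$, so $e^{\mu q}$ commutes with $a_n$ ($n\neq 0$) and $e^{\mu q}|\lambda\rangle=|\lambda+\mu\rangle$.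 Modes: $V_{\sqrt2}(z)=e(z)=\sum_{n}e_nz^{-n-1}$, $V_{-\sqrt2}(z)=f(z)=\sum_n f_nz^{-n-1}$. **The Lie algebra.** $\widehat{\mathfrak{sl}_2}'=\mathfrak{sl}_2\otimes\mathbb{C}[t,t^{-1}]\oplus\mathbb{C}K$ with generators $e_n,f_n,h_n$ ($x_n=x\otimes t^n$), $K$ central, and $[e_n,e_m]=[f_n,f_m]=0$, $[e_n,f_m]=h_{n+m}+n\delta_{n,-m}K$, $[h_n,e_m]=2e_{n+m}$, $[h_n,f_m]=-2f_{n+m}$, $[h_n,h_m]=2n\delta_{n,-m}K$. Let $\hat{\mathfrak n}_+=\langle e_0\rangle+\sum_{k>0}t^k\mathfrak{sl}_2$. $L_{(l,k)}$ denotes the irreducible module with cyclic vector $v$ such that $\hat{\mathfrak n}_+v=0$, $h_0v=lv$, $Kv=kv$. It is well known that $V_{\sqrt2\,\mathbb{Z}}\simeq L_{(0,1)}$, where $e_n,f_n$ act as the modes above, $h_n$ acts as $\sqrt2\,a_n$, $K$ acts as $1$, and $v=|0\rangle$. The operators $e_i$ ($i\in\mathbb Z$) commute, and $\mathbb{C}[e_i\mid i\in\mathbb{Z}]\,|j\sqrt2\rangle$ is the linear span of all vectors $e_{i_1}\cdots e_{i_k}|j\sqrt2\rangle$, $k\ge0$. *)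

theory Defs
  imports Complex_Main "HOL-Library.Poly_Mapping" "HOL-Library.Multiset"
begin

section \<open>Complex vector spaces with a given basis\<close>

text \<open>
  \<^typ>\<open>'b \<Rightarrow>\<^sub>0 complex\<close> is the complex vector space with basis \<^typ>\<open>'b\<close>;
  the basis vector belonging to \<open>b\<close> is \<open>Poly_Mapping.single b 1\<close>.
\<close>

definition cscale :: "complex \<Rightarrow> ('b \<Rightarrow>\<^sub>0 complex) \<Rightarrow> ('b \<Rightarrow>\<^sub>0 complex)"  (infixr \<open>*\<^sub>c\<close> 75)
  where "c *\<^sub>c v = Poly_Mapping.map (\<lambda>x. c * x) v"

definition lin_ext ::
    "('b \<Rightarrow> ('c \<Rightarrow>\<^sub>0 complex)) \<Rightarrow> ('b \<Rightarrow>\<^sub>0 complex) \<Rightarrow> ('c \<Rightarrow>\<^sub>0 complex)"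
  where "lin_ext f v = (\<Sum>b\<in>Poly_Mapping.keys v. Poly_Mapping.lookup v b *\<^sub>c f b)"

lemma lookup_cscale [simp]:
  "Poly_Mapping.lookup (c *\<^sub>c v) b = c * Poly_Mapping.lookup v b"
  unfolding cscale_def by transfer (auto simp: when_def)

lemma vector_space_cscale: "vector_space cscale"
  by unfold_locales
    (auto intro!: poly_mapping_eqI simp: lookup_add algebra_simps)

lemma lin_ext_single: "lin_ext f (Poly_Mapping.single b c) = c *\<^sub>c f b"
  by (auto simp: lin_ext_def intro!: poly_mapping_eqI)

lemma lin_ext_superset:
  assumes "finite A" "Poly_Mapping.keys v \<subseteq> A"
  shows "lin_ext f v = (\<Sum>b\<in>A. Poly_Mapping.lookup v b *\<^sub>c f b)"
  unfolding lin_ext_def using assms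
  by (intro sum.mono_neutral_left) (auto simp: in_keys_iff intro!: poly_mapping_eqI)

lemma lin_ext_add: "lin_ext f (v + w) = lin_ext f v + lin_ext f w"
proof -
  let ?A = "Poly_Mapping.keys v \<union> Poly_Mapping.keys w"
  have "lin_ext f (v + w) = (\<Sum>b\<in>?A. Poly_Mapping.lookup (v + w) b *\<^sub>c f b)"
    by (intro lin_ext_superset keys_add) auto
  moreover have "lin_ext f v = (\<Sum>b\<in>?A. Poly_Mapping.lookup v b *\<^sub>c f b)"
    and "lin_ext f w = (\<Sum>b\<in>?A. Poly_Mapping.lookup w b *\<^sub>c f b)"
    by (intro lin_ext_superset; auto)+
  moreover have "Poly_Mapping.lookup (v + w) b *\<^sub>c f b =
      Poly_Mapping.lookup v b *\<^sub>c f b + Poly_Mapping.lookup w b *\<^sub>c f b" for b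
    by (intro poly_mapping_eqI) (simp add: lookup_add algebra_simps)
  ultimately show ?thesis by (simp add: sum.distrib)
qed

lemma lin_ext_cscale: "lin_ext f (c *\<^sub>c v) = c *\<^sub>c lin_ext f v"
proof -
  have "lin_ext f (c *\<^sub>c v) = (\<Sum>b\<in>Poly_Mapping.keys v. Poly_Mapping.lookup (c *\<^sub>c v) b *\<^sub>c f b)"
    by (intro lin_ext_superset) (auto simp: in_keys_iff)
  also have "\<dots> = c *\<^sub>c lin_ext f v"
    unfolding lin_ext_def
    by (intro poly_mapping_eqI) (simp add: lookup_sum sum_distrib_left mult.assoc)
  finally show ?thesis .
qed

lemma lin_ext_zero: "lin_ext f 0 = 0"
  by (simp add: lin_ext_def)

lemma lin_ext_uminus: "lin_ext f (- v) = - lin_ext f v"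
  using lin_ext_add[of f v "- v"] by (simp add: lin_ext_zero eq_neg_iff_add_eq_0 add.commute)

lemma lin_ext_diff: "lin_ext f (v - w) = lin_ext f v - lin_ext f w"
  using lin_ext_add[of f v "- w"] by (simp add: lin_ext_uminus)

lemma keys_lin_ext: "Poly_Mapping.keys (lin_ext f v) \<subseteq> (\<Union>b\<in>Poly_Mapping.keys v. Poly_Mapping.keys (f b))"
proof
  fix x assume "x \<in> Poly_Mapping.keys (lin_ext f v)"
  hence "(\<Sum>b\<in>Poly_Mapping.keys v. Poly_Mapping.lookup v b * Poly_Mapping.lookup (f b) x) \<noteq> 0"
    by (simp add: in_keys_iff lin_ext_def lookup_sum)
  then obtain b where "b \<in> Poly_Mapping.keys v" "Poly_Mapping.lookup (f b) x \<noteq> 0"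
    by (auto elim: sum.not_neutral_contains_not_neutral)
  thus "x \<in> (\<Union>b\<in>Poly_Mapping.keys v. Poly_Mapping.keys (f b))" by (auto simp: in_keys_iff)
qed


section \<open>The lattice vertex algebra\<close>

text \<open>
  The pair \<open>(j, M)\<close> labels the basis vector \<open>(\<Prod>i\<in>#M. a\<^bsub>-(i+1)\<^esub>) |j\<surd>2\<rangle>\<close>
  of \<open>V\<^bsub>\<surd>2\<int>\<^esub> = \<Oplus>\<^bsub>j\<^esub> F\<^bsub>j\<surd>2\<^esub>\<close>; note the shift by one in the multiset \<open>M\<close>.
  These vectors form a basis because each Fock module \<open>F\<^bsub>\<mu>\<^esub>\<close> is freely generated from
  its highest weight vector by the commuting operators \<open>a\<^bsub>n\<^esub>\<close>, \<open>n < 0\<close>.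
\<close>

type_synonym lattice_va = "(int \<times> nat multiset) \<Rightarrow>\<^sub>0 complex"

definition mom :: "int \<Rightarrow> real"
  where "mom j = sqrt 2 * of_int j"

definition ket :: "int \<Rightarrow> lattice_va"
  where "ket j = Poly_Mapping.single (j, {#}) 1"

text \<open>
  The Heisenberg operators \<open>a\<^bsub>n\<^esub>\<close>.  For \<open>n > 0\<close> the formula below is what
  \<open>[a\<^bsub>n\<^esub>, a\<^bsub>m\<^esub>] = n \<delta>\<^bsub>n+m,0\<^esub>\<close> and \<open>a\<^bsub>n\<^esub> |\<mu>\<rangle> = 0\<close> force, i.e. \<open>n \<partial>/\<partial>a\<^bsub>-n\<^esub>\<close>.
\<close>

definition heis_basis :: "int \<Rightarrow> int \<times> nat multiset \<Rightarrow> lattice_va"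
  where "heis_basis n = (\<lambda>(j, M).
    if n < 0 then Poly_Mapping.single (j, add_mset (nat (- n - 1)) M) 1
    else if n = 0 then Poly_Mapping.single (j, M) (of_real (mom j))
    else Poly_Mapping.single (j, M - {#nat (n - 1)#}) (of_int n * of_nat (count M (nat (n - 1)))))"

definition heis :: "int \<Rightarrow> lattice_va \<Rightarrow> lattice_va"
  where "heis n = lin_ext (heis_basis n)"

text \<open>\<open>e\<^bsup>\<mu>q\<^esup>\<close> for \<open>\<mu> = k\<surd>2\<close>.\<close>

definition shift :: "int \<Rightarrow> lattice_va \<Rightarrow> lattice_va"
  where "shift k = lin_ext (\<lambda>(j, M). Poly_Mapping.single (j + k, M) 1)"

text \<open>
  The coefficient of \<open>z\<^bsup>p\<^esup>\<close> in \<open>z\<^bsup>\<mu> a\<^sub>0\<^esup>\<close> for \<open>\<mu> = k\<surd>2\<close>: as \<open>z\<^bsup>\<mu> a\<^sub>0\<^esup>\<close> is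
  multiplication by \<open>z\<^bsup>\<mu>\<lambda>\<^esup>\<close> on \<open>F\<^bsub>\<lambda>\<^esub>\<close>, this is the projection onto the sum of the
  \<open>F\<^bsub>\<lambda>\<^esub>\<close> with \<open>\<mu>\<lambda> = p\<close>.  Only integers \<open>p\<close> occur, since \<open>k\<surd>2 \<cdot> j\<surd>2 = 2kj\<close>.
\<close>

definition zpow_coeff :: "int \<Rightarrow> int \<Rightarrow> lattice_va \<Rightarrow> lattice_va"
  where "zpow_coeff k p = lin_ext (\<lambda>(j, M).
    if mom k * mom j = of_int p then Poly_Mapping.single (j, M) 1 else 0)"

text \<open>
  For operators \<open>b\<^sub>1, b\<^sub>2, \<dots>\<close>, the coefficients of \<open>x\<^bsup>r\<^esup>\<close> in
  \<open>(\<Sum>\<^bsub>m\<ge>1\<^esub> b\<^bsub>m\<^esub> x\<^bsup>m\<^esup>)\<^bsup>k\<^esup>\<close> and in \<open>exp (\<Sum>\<^bsub>m\<ge>1\<^esub> b\<^bsub>m\<^esub> x\<^bsup>m\<^esup>)\<close>.  In the latter only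
  the powers \<open>k \<le> r\<close> contribute.
\<close>

primrec series_pow ::
    "(nat \<Rightarrow> lattice_va \<Rightarrow> lattice_va) \<Rightarrow> nat \<Rightarrow> nat \<Rightarrow> lattice_va \<Rightarrow> lattice_va"
  where
    "series_pow b 0 r v = (if r = 0 then v else 0)"
  | "series_pow b (Suc k) r v = (\<Sum>m=1..r. b m (series_pow b k (r - m) v))"

definition series_exp :: "(nat \<Rightarrow> lattice_va \<Rightarrow> lattice_va) \<Rightarrow> nat \<Rightarrow> lattice_va \<Rightarrow> lattice_va"
  where "series_exp b r v = (\<Sum>k\<le>r. (1 / fact k) *\<^sub>c series_pow b k r v)"

text \<open>
  The coefficients of \<open>z\<^bsup>r\<^esup>\<close> in \<open>exp (- \<mu> \<Sum>\<^bsub>n<0\<^esub> (a\<^bsub>n\<^esub>/n) z\<^bsup>-n\<^esup>)\<close> and of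
  \<open>z\<^bsup>-s\<^esup>\<close> in \<open>exp (- \<mu> \<Sum>\<^bsub>n>0\<^esub> (a\<^bsub>n\<^esub>/n) z\<^bsup>-n\<^esup>)\<close>, with \<open>\<mu> = k\<surd>2\<close>.
\<close>

definition creation_exp :: "int \<Rightarrow> nat \<Rightarrow> lattice_va \<Rightarrow> lattice_va"
  where "creation_exp k =
    series_exp (\<lambda>m v. (- of_real (mom k) / of_int (- int m)) *\<^sub>c heis (- int m) v)"

definition annihilation_exp :: "int \<Rightarrow> nat \<Rightarrow> lattice_va \<Rightarrow> lattice_va"
  where "annihilation_exp k =
    series_exp (\<lambda>m v. (- of_real (mom k) / of_int (int m)) *\<^sub>c heis (int m) v)"

text \<open>
  \<open>vertex_mode k n\<close> is the coefficient of \<open>z\<^bsup>-n-1\<^esup>\<close> in \<open>V\<^bsub>k\<surd>2\<^esub>(z)\<close>.  The three series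
  contribute \<open>z\<^bsup>p\<^esup>\<close>, \<open>z\<^bsup>r\<^esup>\<close> and \<open>z\<^bsup>-s\<^esup>\<close> with \<open>p + r - s = - n - 1\<close>.  On each vector
  the sum over \<open>r\<close>, \<open>s\<close> has only finitely many nonzero terms (see
  \<open>finite_vertex_summands\<close> below), so \<^const>\<open>Sum_any\<close> is the sum intended.
\<close>

definition vertex_summand :: "int \<Rightarrow> int \<Rightarrow> lattice_va \<Rightarrow> nat \<times> nat \<Rightarrow> lattice_va"
  where "vertex_summand k n v = (\<lambda>(r, s).
    shift k (zpow_coeff k (- n - 1 - int r + int s) (creation_exp k r (annihilation_exp k s v))))"

definition vertex_mode :: "int \<Rightarrow> int \<Rightarrow> lattice_va \<Rightarrow> lattice_va"
  where "vertex_mode k n v = Sum_any (vertex_summand k n v)"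

definition e_mode :: "int \<Rightarrow> lattice_va \<Rightarrow> lattice_va"
  where "e_mode = vertex_mode 1"

definition f_mode :: "int \<Rightarrow> lattice_va \<Rightarrow> lattice_va"
  where "f_mode = vertex_mode (- 1)"

definition W_sqrt2_part :: "int \<Rightarrow> lattice_va set"
  where "W_sqrt2_part j = module.span cscale {foldr e_mode is (ket j) | is. True}"

definition W_sqrt2 :: "lattice_va set"
  where "W_sqrt2 = (\<Union>j. W_sqrt2_part j)"


section \<open>The affine Lie algebra\<close>

datatype affine_gen = E int | F int | H int | K

type_synonym affine_sl2 = "affine_gen \<Rightarrow>\<^sub>0 complex"

abbreviation gen :: "affine_gen \<Rightarrow> affine_sl2"
  where "gen g \<equiv> Poly_Mapping.single g 1"

fun gen_bracket :: "affine_gen \<Rightarrow> affine_gen \<Rightarrow> affine_sl2"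
  where
    "gen_bracket (E n) (E m) = 0"
  | "gen_bracket (F n) (F m) = 0"
  | "gen_bracket (E n) (F m) = gen (H (n + m)) + (if n = - m then of_int n *\<^sub>c gen K else 0)"
  | "gen_bracket (F m) (E n) = - (gen (H (n + m)) + (if n = - m then of_int n *\<^sub>c gen K else 0))"
  | "gen_bracket (H n) (E m) = 2 *\<^sub>c gen (E (n + m))"
  | "gen_bracket (E m) (H n) = - (2 *\<^sub>c gen (E (n + m)))"
  | "gen_bracket (H n) (F m) = (- 2) *\<^sub>c gen (F (n + m))"
  | "gen_bracket (F m) (H n) = - ((- 2) *\<^sub>c gen (F (n + m)))"
  | "gen_bracket (H n) (H m) = (if n = - m then (2 * of_int n) *\<^sub>c gen K else 0)"
  | "gen_bracket K g = 0"
  | "gen_bracket g K = 0"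

definition lie_bracket :: "affine_sl2 \<Rightarrow> affine_sl2 \<Rightarrow> affine_sl2"
  where "lie_bracket x y = lin_ext (\<lambda>g. lin_ext (gen_bracket g) y) x"

definition n_plus :: "affine_sl2 set"
  where "n_plus = module.span cscale
    ({gen (E 0)} \<union> (\<Union>k\<in>{0<..}. {gen (E k), gen (F k), gen (H k)}))"


section \<open>Modules over the affine Lie algebra\<close>

text \<open>
  In the following \<open>s\<close> is the scalar multiplication of the module and \<open>\<rho>\<close> the action.
\<close>

definition affine_module ::
    "(complex \<Rightarrow> 'v \<Rightarrow> 'v::ab_group_add) \<Rightarrow> (affine_sl2 \<Rightarrow> 'v \<Rightarrow> 'v) \<Rightarrow> bool"
  where "affine_module s \<rho> \<longleftrightarrow>
    vector_space s \<and>
    (\<forall>x. Vector_Spaces.linear s s (\<rho> x)) \<and>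
    (\<forall>v. Vector_Spaces.linear cscale s (\<lambda>x. \<rho> x v)) \<and>
    (\<forall>x y v. \<rho> (lie_bracket x y) v = \<rho> x (\<rho> y v) - \<rho> y (\<rho> x v))"

definition affine_invariant :: "(affine_sl2 \<Rightarrow> 'v \<Rightarrow> 'v) \<Rightarrow> 'v set \<Rightarrow> bool"
  where "affine_invariant \<rho> U \<longleftrightarrow> (\<forall>x. \<forall>u\<in>U. \<rho> x u \<in> U)"

definition affine_submodule ::
    "(complex \<Rightarrow> 'v \<Rightarrow> 'v::ab_group_add) \<Rightarrow> (affine_sl2 \<Rightarrow> 'v \<Rightarrow> 'v) \<Rightarrow> 'v set \<Rightarrow> bool"
  where "affine_submodule s \<rho> U \<longleftrightarrow> module.subspace s U \<and> affine_invariant \<rho> U"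

definition irreducible_affine_module ::
    "(complex \<Rightarrow> 'v \<Rightarrow> 'v::ab_group_add) \<Rightarrow> (affine_sl2 \<Rightarrow> 'v \<Rightarrow> 'v) \<Rightarrow> bool"
  where "irreducible_affine_module s \<rho> \<longleftrightarrow>
    affine_module s \<rho> \<and> (UNIV :: 'v set) \<noteq> {0} \<and>
    (\<forall>U. affine_submodule s \<rho> U \<longrightarrow> U = {0} \<or> U = UNIV)"

definition cyclic_vector ::
    "(complex \<Rightarrow> 'v \<Rightarrow> 'v::ab_group_add) \<Rightarrow> (affine_sl2 \<Rightarrow> 'v \<Rightarrow> 'v) \<Rightarrow> 'v \<Rightarrow> bool"
  where "cyclic_vector s \<rho> v \<longleftrightarrow> (\<forall>U. affine_submodule s \<rho> U \<and> v \<in> U \<longrightarrow> U = UNIV)"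

text \<open>
  \<open>is_L l k s \<rho> v\<close>: the module \<open>(s, \<rho>)\<close> together with the vector \<open>v\<close> is \<open>L\<^bsub>(l,k)\<^esub>\<close>.
  The module \<open>L\<^bsub>(l,k)\<^esub>\<close> is given only up to isomorphism, by the following properties;
  they are invariant under isomorphism, so \<open>V \<simeq> L\<^bsub>(l,k)\<^esub>\<close> means that \<open>V\<close> has them.
\<close>

definition is_L ::
    "complex \<Rightarrow> complex \<Rightarrow> (complex \<Rightarrow> 'v \<Rightarrow> 'v::ab_group_add) \<Rightarrow> (affine_sl2 \<Rightarrow> 'v \<Rightarrow> 'v) \<Rightarrow> 'v \<Rightarrow> bool"
  where "is_L l k s \<rho> v \<longleftrightarrow>
    irreducible_affine_module s \<rho> \<and> cyclic_vector s \<rho> v \<and>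
    (\<forall>x\<in>n_plus. \<rho> x v = 0) \<and> \<rho> (gen (H 0)) v = s l v \<and> \<rho> (gen K) v = s k v"

fun gen_action :: "affine_gen \<Rightarrow> lattice_va \<Rightarrow> lattice_va"
  where
    "gen_action (E n) v = e_mode n v"
  | "gen_action (F n) v = f_mode n v"
  | "gen_action (H n) v = of_real (sqrt 2) *\<^sub>c heis n v"
  | "gen_action K v = v"

definition affine_action :: "affine_sl2 \<Rightarrow> lattice_va \<Rightarrow> lattice_va"
  where "affine_action x v = lin_ext (\<lambda>g. gen_action g v) x"

section \<open>Basic facts\<close>

lemma heis_zero_ket: "heis 0 (ket j) = of_real (mom j) *\<^sub>c ket j"
  by (auto simp: heis_def ket_def lin_ext_single heis_basis_def lookup_single when_def
      intro!: poly_mapping_eqI)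

lemma heis_pos_ket: "n > 0 \<Longrightarrow> heis n (ket j) = 0"
  by (auto simp: heis_def ket_def lin_ext_single heis_basis_def intro!: poly_mapping_eqI)

lemma shift_ket: "shift k (ket j) = ket (j + k)"
  by (auto simp: shift_def ket_def lin_ext_single intro!: poly_mapping_eqI)

lemma heis_monomial:
  "foldr (\<lambda>i. heis (- int i - 1)) is (ket j) = Poly_Mapping.single (j, mset is) 1"
  by (induction "is")
    (auto simp: ket_def heis_def lin_ext_single heis_basis_def intro!: poly_mapping_eqI)

lemma linear_eq_on_basis:
  fixes A B :: "('b \<Rightarrow>\<^sub>0 complex) \<Rightarrow> ('c \<Rightarrow>\<^sub>0 complex)"
  assumes add: "\<And>v w. A (v + w) = A v + A w" "\<And>v w. B (v + w) = B v + B w"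
    and basis: "\<And>b c. A (Poly_Mapping.single b c) = B (Poly_Mapping.single b c)"
  shows "A v = B v"
proof -
  have v: "v = (\<Sum>b\<in>Poly_Mapping.keys v. Poly_Mapping.single b (Poly_Mapping.lookup v b))"
    by (intro poly_mapping_eqI) (auto simp: lookup_sum lookup_single when_def in_keys_iff)
  have zero: "A 0 = 0" "B 0 = 0"
    using add(1)[of 0 0] add(2)[of 0 0] by auto
  have "A (\<Sum>b\<in>S. Poly_Mapping.single b (g b)) = B (\<Sum>b\<in>S. Poly_Mapping.single b (g b))"
    if "finite S" for S g
    using that by induction (auto simp: zero add basis)
  with v show ?thesis by (metis finite_keys)
qed

lemma heis_add: "heis n (v + w) = heis n v + heis n w"
  by (simp add: heis_def lin_ext_add)

lemma cscale_add: "c *\<^sub>c (v + w) = c *\<^sub>c v + c *\<^sub>c w"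
  by (rule poly_mapping_eqI) (simp add: lookup_add algebra_simps)

lemma cscale_single: "c *\<^sub>c Poly_Mapping.single b d = Poly_Mapping.single b (c * d)"
  by (rule poly_mapping_eqI) (simp add: lookup_single when_def)

lemma cscale_zero: "c *\<^sub>c 0 = (0 :: 'b \<Rightarrow>\<^sub>0 complex)"
  by (rule poly_mapping_eqI) simp

lemma heis_single:
  "heis (- int i - 1) (Poly_Mapping.single (j, M) c) = Poly_Mapping.single (j, add_mset i M) c"
  "heis 0 (Poly_Mapping.single (j, M) c) = Poly_Mapping.single (j, M) (c * of_real (mom j))"
  "heis (int i + 1) (Poly_Mapping.single (j, M) c) =
    Poly_Mapping.single (j, M - {#i#}) (c * (of_nat (i + 1) * of_nat (count M i)))"
  by (simp_all add: heis_def lin_ext_single heis_basis_def cscale_single add.commute)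

lemma heis_commutator:
  "heis n (heis m v) - heis m (heis n v) = (if n + m = 0 then of_int n *\<^sub>c v else 0)"
proof (rule linear_eq_on_basis[where v = v])
  fix b :: "int \<times> nat multiset" and c :: complex
  obtain j M where b: "b = (j, M)" by force
  define w where "w = Poly_Mapping.single (j, M) c"
  have cases: "(\<exists>i. n = - int i - 1) \<or> n = 0 \<or> (\<exists>i. n = int i + 1)" for n :: int
  proof (cases "n < 0")
    case True
    hence "n = - int (nat (- n - 1)) - 1" by simp
    thus ?thesis by blast
  next
    case False
    hence "n = 0 \<or> n = int (nat (n - 1)) + 1" by auto
    thus ?thesis by blast
  qed
  have mixed: "heis (int i + 1) (heis (- int k - 1) w) - heis (- int k - 1) (heis (int i + 1) w)
      = (if i = k then of_nat (i + 1) *\<^sub>c w else 0)" for i k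
  proof (cases "i = k")
    case True
    have "add_mset k (M - {#k#}) = M" if "count M k \<noteq> 0"
      using that by (intro insert_DiffM) simp
    hence "Poly_Mapping.single (j, add_mset k (M - {#k#})) (c * (of_nat (k + 1) * of_nat (count M k))) =
        Poly_Mapping.single (j, M) (c * (of_nat (k + 1) * of_nat (count M k)))"
      by (cases "count M k = 0") auto
    with True show ?thesis
      unfolding w_def heis_single cscale_single
      by (simp add: single_diff[symmetric] ring_distribs mult.commute)
  next
    case False
    show ?thesis
    proof (cases "i \<in># M")
      case True
      with \<open>i \<noteq> k\<close> show ?thesis by (simp add: w_def heis_single diff_add_mset_swap)
    next
      case False
      hence "count M i = 0" by (simp add: not_in_iff)
      with \<open>i \<noteq> k\<close> show ?thesis by (simp add: w_def heis_single) (simp add: heis_def lin_ext_zero)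
    qed
  qed
  have pos: "heis (int i + 1) (heis (int k + 1) w) = heis (int k + 1) (heis (int i + 1) w)" for i k
    by (simp add: w_def heis_single diff_right_commute add_mset_commute mult_ac)
  have neg: "heis (- int i - 1) (heis (- int k - 1) w) = heis (- int k - 1) (heis (- int i - 1) w)"
    for i k
    by (simp add: w_def heis_single add_mset_commute)
  have zero: "heis 0 (heis n w) = heis n (heis 0 w)" for n
    using cases[of n] by (auto simp: w_def heis_single mult_ac)
  have zero_scale: "0 *\<^sub>c w = 0"
    by (rule poly_mapping_eqI) simp
  consider (same_neg) i k where "n = - int i - 1" "m = - int k - 1"
    | (same_pos) i k where "n = int i + 1" "m = int k + 1"
    | (zero) "n = 0 \<or> m = 0"
    | (neg_pos) i k where "n = - int i - 1" "m = int k + 1"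
    | (pos_neg) i k where "n = int i + 1" "m = - int k - 1"
    using cases[of n] cases[of m] by metis
  hence "heis n (heis m w) - heis m (heis n w) = (if n + m = 0 then of_int n *\<^sub>c w else 0)"
  proof cases
    case (same_neg i k)
    then show ?thesis using neg[of i k] by simp
  next
    case (same_pos i k)
    then show ?thesis using pos[of i k] by simp
  next
    case zero
    hence "heis n (heis m w) = heis m (heis n w)" using \<open>\<And>n. heis 0 (heis n w) = heis n (heis 0 w)\<close> by auto
    with zero show ?thesis using zero_scale by auto
  next
    case (neg_pos i k)
    have "heis n (heis m w) - heis m (heis n w) = - (heis m (heis n w) - heis n (heis m w))"
      by simp
    also have "\<dots> = (if n + m = 0 then of_int n *\<^sub>c w else 0)"
      unfolding neg_pos mixed by (auto intro!: poly_mapping_eqI simp: algebra_simps)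
    finally show ?thesis .
  next
    case (pos_neg i k)
    thus ?thesis using mixed[of i k] by (auto simp: add.commute)
  qed
  thus "heis n (heis m (Poly_Mapping.single b c)) - heis m (heis n (Poly_Mapping.single b c)) =
      (if n + m = 0 then of_int n *\<^sub>c Poly_Mapping.single b c else 0)"
    by (simp add: b w_def)
qed (auto simp: heis_add cscale_add algebra_simps)


lemma keys_cscale: "Poly_Mapping.keys (c *\<^sub>c v) \<subseteq> Poly_Mapping.keys v"
  by (auto simp: in_keys_iff)

lemma keys_sum_subset:
  "(\<And>i. i \<in> I \<Longrightarrow> Poly_Mapping.keys (f i) \<subseteq> T) \<Longrightarrow> Poly_Mapping.keys (\<Sum>i\<in>I. f i) \<subseteq> T"
proof (induction I rule: infinite_finite_induct)
  case (insert i I)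
  then show ?case using keys_add[of "f i" "sum f I"] by auto
qed auto

lemma keys_series_exp:
  assumes step: "\<And>d m v. m \<ge> 1 \<Longrightarrow> Poly_Mapping.keys v \<subseteq> T d \<Longrightarrow> Poly_Mapping.keys (b m v) \<subseteq> T (d + m)"
    and v: "Poly_Mapping.keys v \<subseteq> T d"
  shows "Poly_Mapping.keys (series_exp b r v) \<subseteq> T (d + r)"
proof -
  have "Poly_Mapping.keys (series_pow b k r v) \<subseteq> T (d + r)" for k r
  proof (induction k arbitrary: r)
    case 0
    then show ?case using v by simp
  next
    case (Suc k)
    show ?case unfolding series_pow.simps
    proof (rule keys_sum_subset)
      fix m assume m: "m \<in> {1..r}"
      hence "Poly_Mapping.keys (b m (series_pow b k (r - m) v)) \<subseteq> T ((d + (r - m)) + m)"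
        by (intro step Suc.IH) auto
      with m show "Poly_Mapping.keys (b m (series_pow b k (r - m) v)) \<subseteq> T (d + r)" by simp
    qed
  qed
  thus ?thesis unfolding series_exp_def
    by (intro keys_sum_subset order_trans[OF keys_cscale])
qed

lemma keys_creation_exp:
  assumes "Poly_Mapping.keys v \<subseteq> J \<times> UNIV"
  shows "Poly_Mapping.keys (creation_exp k r v) \<subseteq> J \<times> UNIV"
  unfolding creation_exp_def
proof (rule keys_series_exp[where T = "\<lambda>_. J \<times> UNIV"])
  fix m :: nat and v :: lattice_va assume "Poly_Mapping.keys v \<subseteq> J \<times> UNIV"
  thus "Poly_Mapping.keys ((- of_real (mom k) / of_int (- int m)) *\<^sub>c heis (- int m) v) \<subseteq> J \<times> UNIV"
    unfolding heis_def
    by (intro order_trans[OF keys_cscale] order_trans[OF keys_lin_ext] UN_least)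
      (auto simp: heis_basis_def split: if_splits)
qed (use assms in auto)

lemma keys_annihilation_exp:
  assumes "Poly_Mapping.keys v \<subseteq> {(j, M). j \<in> J \<and> sum_mset (image_mset Suc M) \<le> D}"
  shows "Poly_Mapping.keys (annihilation_exp k s v) \<subseteq>
    {(j, M). j \<in> J \<and> sum_mset (image_mset Suc M) + s \<le> D}"
proof -
  let ?T = "\<lambda>d. {(j, M). j \<in> J \<and> sum_mset (image_mset Suc M) + d \<le> D}"
  have "Poly_Mapping.keys (annihilation_exp k s v) \<subseteq> ?T (0 + s)"
    unfolding annihilation_exp_def
  proof (rule keys_series_exp[where T = ?T])
    fix m d :: nat and v :: lattice_va
    assume m: "m \<ge> 1" and v: "Poly_Mapping.keys v \<subseteq> ?T d"
    have "Poly_Mapping.keys (heis_basis (int m) b) \<subseteq> ?T (d + m)" if "b \<in> ?T d" for b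
    proof
      fix x assume x: "x \<in> Poly_Mapping.keys (heis_basis (int m) b)"
      obtain j M where b: "b = (j, M)" by force
      let ?i = "nat (int m - 1)"
      from x m have x: "x = (j, M - {#?i#})" and "count M ?i \<noteq> 0"
        by (auto simp: b heis_basis_def split: if_splits)
      hence "?i \<in># M" by simp
      then obtain M' where M': "M = add_mset ?i M'" by (meson multi_member_split)
      have "Suc ?i = m" using m by linarith
      with that show "x \<in> ?T (d + m)" by (auto simp: x b M')
    qed
    with v show "Poly_Mapping.keys ((- of_real (mom k) / of_int (int m)) *\<^sub>c heis (int m) v) \<subseteq> ?T (d + m)"
      unfolding heis_def
      by (intro order_trans[OF keys_cscale] order_trans[OF keys_lin_ext] UN_least) blast
  qed (use assms in auto)
  thus ?thesis by simp
qed

lemma finite_vertex_summands: "finite {rs. vertex_summand k n v rs \<noteq> 0}"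
proof -
  define J where "J = fst ` Poly_Mapping.keys v"
  define D where "D = (\<Sum>(j, M)\<in>Poly_Mapping.keys v. sum_mset (image_mset Suc M))"
  have v: "Poly_Mapping.keys v \<subseteq> {(j, M). j \<in> J \<and> sum_mset (image_mset Suc M) \<le> D}"
  proof clarify
    fix j M assume jM: "(j, M) \<in> Poly_Mapping.keys v"
    hence "sum_mset (image_mset Suc M) \<le> D"
      unfolding D_def by (intro order_trans[OF _ member_le_sum[OF jM]]) auto
    with jM show "j \<in> J \<and> sum_mset (image_mset Suc M) \<le> D" by (force simp: J_def)
  qed
  have "{rs. vertex_summand k n v rs \<noteq> 0} \<subseteq>
      (\<lambda>(j, s). (nat (- n - 1 + int s - 2 * k * j), s)) ` (J \<times> {..D})"
  proof clarify
    fix r s assume nz: "vertex_summand k n v (r, s) \<noteq> 0"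
    let ?p = "- n - 1 - int r + int s"
    let ?w = "annihilation_exp k s v"
    let ?u = "creation_exp k r ?w"
    have w: "Poly_Mapping.keys ?w \<subseteq> {(j, M). j \<in> J \<and> sum_mset (image_mset Suc M) + s \<le> D}"
      by (rule keys_annihilation_exp[OF v])
    have u: "Poly_Mapping.keys ?u \<subseteq> fst ` Poly_Mapping.keys ?w \<times> UNIV"
      by (rule keys_creation_exp) force
    have "zpow_coeff k ?p ?u \<noteq> 0"
      using nz by (auto simp: vertex_summand_def shift_def lin_ext_def)
    then obtain j M where jM: "(j, M) \<in> Poly_Mapping.keys ?u" and p: "mom k * mom j = of_int ?p"
      unfolding zpow_coeff_def lin_ext_def
      by (force elim!: sum.not_neutral_contains_not_neutral simp: cscale_zero split: if_splits)
    have "mom k * mom j = of_int (2 * k * j)" by (simp add: mom_def)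
    with p have "2 * k * j = ?p" by (metis of_int_eq_iff)
    moreover from jM u obtain M' where "(j, M') \<in> Poly_Mapping.keys ?w" by force
    with w have "j \<in> J" "s \<le> D" by auto
    ultimately show "(r, s) \<in> (\<lambda>(j, s). (nat (- n - 1 + int s - 2 * k * j), s)) ` (J \<times> {..D})"
      by (intro image_eqI[of _ _ "(j, s)"]) auto
  qed
  moreover have "finite (J \<times> {..D})" by (simp add: J_def)
  ultimately show ?thesis by (meson finite_imageI finite_subset)
qed

lemma gen_bracket_antisym: "gen_bracket g h = - gen_bracket h g"
  by (cases g; cases h)
    (auto intro!: poly_mapping_eqI simp: lookup_add lookup_single when_def algebra_simps)

lemma of_int_eq_neg: "a + b = - c \<Longrightarrow> complex_of_int c = - (of_int a + of_int b)"
  by (metis minus_minus of_int_add of_int_minus)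

lemma gen_jacobi:
  "lin_ext (gen_bracket a) (gen_bracket b c) + lin_ext (gen_bracket b) (gen_bracket c a)
    + lin_ext (gen_bracket c) (gen_bracket a b) = 0"
  by (cases a; cases b; cases c, auto simp: lin_ext_add lin_ext_cscale lin_ext_single lin_ext_zero lin_ext_uminus lin_ext_diff
      lookup_add lookup_minus lookup_single when_def algebra_simps intro!: poly_mapping_eqI)
    (drule of_int_eq_neg, simp add: ring_distribs)+

end

theory Submission
  imports Defs
begin

text \<open>
  The commutator \<open>[a\<^bsub>m\<^esub>, V\<^bsub>n\<^esub>] = \<mu> V\<^bsub>n+m\<^esub>\<close> shows that a candidate relation between
  products of two modes is determined by its vacuum coefficients in degree 0, which are
  coefficients of \<open>(1 - x)\<^bsup>\<mu>\<nu>\<^esup>\<close>; this yields the relations of the affine Lie algebra.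
  In a nonzero submodule a vector of minimal support is killed by all \<open>a\<^bsub>m\<^esub>\<close>, \<open>m > 0\<close>, and is
  an eigenvector of \<open>a\<^sub>0\<close>, so it is a multiple of some \<open>|j\<surd>2\<rangle>\<close>, from which \<open>e\<close>, \<open>f\<close> and the
  \<open>a\<^bsub>-m\<^esub>\<close> reach everything.  Finally the parts of \<open>W\<close> form a chain, since
  \<open>|(j+1)\<surd>2\<rangle>\<close> is a mode of \<open>e\<close> applied to \<open>|j\<surd>2\<rangle>\<close>, and \<open>W\<close> is closed under
  \<open>a\<^bsub>-r\<^esub>\<close> by induction on \<open>r\<close>: \<open>a\<^bsub>-r\<^esub>|j\<surd>2\<rangle>\<close> is, up to a factor, a mode of \<open>e\<close> applied to
  \<open>|(j-1)\<surd>2\<rangle>\<close> plus terms involving only \<open>a\<^bsub>-m\<^esub>\<close> with \<open>m < r\<close>.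
\<close>

section \<open>Linear maps between complex vector spaces with a given basis\<close>

abbreviation clinear :: "(('b \<Rightarrow>\<^sub>0 complex) \<Rightarrow> ('c \<Rightarrow>\<^sub>0 complex)) \<Rightarrow> bool"
  where "clinear \<equiv> Vector_Spaces.linear cscale cscale"

interpretation cv: vector_space "cscale :: complex \<Rightarrow> ('b \<Rightarrow>\<^sub>0 complex) \<Rightarrow> _"
  by (rule vector_space_cscale)

interpretation cvp: vector_space_pair
    "cscale :: complex \<Rightarrow> ('b \<Rightarrow>\<^sub>0 complex) \<Rightarrow> _" "cscale :: complex \<Rightarrow> ('c \<Rightarrow>\<^sub>0 complex) \<Rightarrow> _"
  by unfold_locales

lemma clinearI:
  assumes "\<And>v w. f (v + w) = f v + f w" "\<And>c v. f (c *\<^sub>c v) = c *\<^sub>c f v"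
  shows "clinear f"
  unfolding Vector_Spaces.linear_iff using assms by (auto intro: vector_space_cscale)

lemma clinear_lin_ext: "clinear (lin_ext f)"
  by (intro clinearI lin_ext_add lin_ext_cscale)

lemma clinear_heis: "clinear (heis n)"
  and clinear_shift: "clinear (shift k)"
  and clinear_zpow: "clinear (zpow_coeff k p)"
  unfolding heis_def shift_def zpow_coeff_def by (rule clinear_lin_ext)+

lemma clinear_scaled: "clinear f \<Longrightarrow> clinear (\<lambda>v. c *\<^sub>c f v)"
  by (rule cvp.linear_compose_scale_right)

lemma clinear_compose: "clinear f \<Longrightarrow> clinear g \<Longrightarrow> clinear (\<lambda>v. f (g v))"
  using Vector_Spaces.linear_compose[of cscale cscale g cscale f] by (simp add: o_def)

lemma clinear_eqI:
  fixes f :: "('a \<Rightarrow>\<^sub>0 complex) \<Rightarrow> ('b \<Rightarrow>\<^sub>0 complex)"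
  assumes "clinear f" "clinear g" "\<And>b. f (Poly_Mapping.single b 1) = g (Poly_Mapping.single b 1)"
  shows "f v = g v"
proof (rule linear_eq_on_basis[where A = f and B = g])
  fix b :: 'a and c
  have "Poly_Mapping.single b c = c *\<^sub>c Poly_Mapping.single b 1" by (simp add: cscale_single)
  then show "f (Poly_Mapping.single b c) = g (Poly_Mapping.single b c)"
    using assms by (simp add: cvp.linear_scale)
qed (use assms in \<open>simp_all add: cvp.linear_add\<close>)

section \<open>Exponentials of operator series\<close>

text \<open>The series has no constant term, so its \<open>k\<close>-th power starts at x^k. Sums
  over powers may therefore be cut off at any bound that is at least \<open>r\<close>.\<close>

lemma series_pow_eq_0: "(\<And>m. clinear (b m)) \<Longrightarrow> r < k \<Longrightarrow> series_pow b k r v = 0"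
proof (induction k arbitrary: r)
  case (Suc k)
  have "b m (series_pow b k (r - m) v) = 0" if "m \<in> {1..r}" for m
    using Suc that by (subst Suc.IH) (auto simp: cvp.linear_0)
  then show ?case by simp
qed auto

lemma sum_triangle_swap:
  fixes f :: "nat \<Rightarrow> nat \<Rightarrow> 'a::comm_monoid_add"
  shows "(\<Sum>m=1..r. \<Sum>l=1..r-m. f m l) = (\<Sum>l=1..r. \<Sum>m=1..r-l. f m l)"
proof -
  have "(\<Sum>m=1..r. \<Sum>l=1..r-m. f m l) = (\<Sum>(m,l)\<in>(SIGMA m:{1..r}. {1..r-m}). f m l)"
    by (subst sum.Sigma) auto
  also have "\<dots> = (\<Sum>(l,m)\<in>(SIGMA l:{1..r}. {1..r-l}). f m l)"
    by (rule sum.reindex_bij_witness[where i = prod.swap and j = prod.swap]) auto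
  also have "\<dots> = (\<Sum>l=1..r. \<Sum>m=1..r-l. f m l)"
    by (subst sum.Sigma) auto
  finally show ?thesis .
qed

text \<open>Coefficient form of x (B^(k+1))' = (k+1) x B' B^k for B = sum of b_m x^m. Commutativity
  of the b_m allows the differentiated factor to be moved to the front.\<close>

lemma series_pow_rec:
  assumes lin: "\<And>m. clinear (b m)" and comm: "\<And>m n v. b m (b n v) = b n (b m v)"
  shows "of_nat r *\<^sub>c series_pow b (Suc k) r v =
    of_nat (Suc k) *\<^sub>c (\<Sum>m=1..r. of_nat m *\<^sub>c b m (series_pow b k (r - m) v))"
proof (induction k arbitrary: r)
  case 0
  have "(\<Sum>m=1..r. g m *\<^sub>c b m (series_pow b 0 (r - m) v)) = (if r = 0 then 0 else g r *\<^sub>c b r v)"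
    for g :: "nat \<Rightarrow> complex"
  proof -
    have "(\<Sum>m=1..r. g m *\<^sub>c b m (series_pow b 0 (r - m) v)) =
        (\<Sum>m=1..r. if m = r then g r *\<^sub>c b r v else 0)"
      using lin by (intro sum.cong) (auto simp: cvp.linear_0)
    then show ?thesis by (auto simp: Suc_le_eq)
  qed
  from this[of "\<lambda>_. 1"] this[of of_nat] show ?case by simp
next
  case (Suc k)
  let ?S = "\<Sum>m=1..r. of_nat m *\<^sub>c b m (series_pow b (Suc k) (r - m) v)"
  \<comment> \<open>Product rule: in r = m + (r - m), the part m differentiates the leading factor
    and r - m the remaining power.\<close>
  have "of_nat r *\<^sub>c series_pow b (Suc (Suc k)) r v =
      (\<Sum>m=1..r. (of_nat m + of_nat (r - m)) *\<^sub>c b m (series_pow b (Suc k) (r - m) v))"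
    by (simp add: cv.scale_sum_right of_nat_add[symmetric] del: series_pow.simps(2)[of b k] of_nat_add)
  also have "\<dots> = ?S + (\<Sum>m=1..r. b m (of_nat (r - m) *\<^sub>c series_pow b (Suc k) (r - m) v))"
    unfolding sum.distrib[symmetric] using lin
    by (intro sum.cong)
      (simp_all add: cv.scale_left_distrib cv.scale_left_diff_distrib cvp.linear_scale cvp.linear_diff del: series_pow.simps)
  also have "(\<Sum>m=1..r. b m (of_nat (r - m) *\<^sub>c series_pow b (Suc k) (r - m) v)) =
      (\<Sum>m=1..r. \<Sum>l=1..r-m. of_nat (Suc k) *\<^sub>c (of_nat l *\<^sub>c b m (b l (series_pow b k (r - m - l) v))))"
    using lin by (simp only: Suc.IH) (simp add: cvp.linear_scale cvp.linear_sum cv.scale_sum_right)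
  also have "\<dots> = (\<Sum>l=1..r. \<Sum>m=1..r-l. of_nat (Suc k) *\<^sub>c (of_nat l *\<^sub>c b l (b m (series_pow b k (r - l - m) v))))"
    by (subst sum_triangle_swap) (simp add: comm add.commute)
  also have "\<dots> = of_nat (Suc k) *\<^sub>c ?S"
    using lin by (simp add: cvp.linear_scale cvp.linear_sum cv.scale_sum_right)
  finally show ?case
    unfolding of_nat_Suc[of "Suc k"] by (simp only: cv.scale_left_distrib cv.scale_one)
qed

text \<open>Formally, \<open>x (exp B(x))' = x B'(x) exp B(x)\<close>.\<close>

lemma series_exp_rec:
  assumes lin: "\<And>m. clinear (b m)" and comm: "\<And>m n v. b m (b n v) = b n (b m v)"
  shows "of_nat r *\<^sub>c series_exp b r v = (\<Sum>m=1..r. of_nat m *\<^sub>c b m (series_exp b (r - m) v))"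
proof (cases r)
  case (Suc r')
  have "of_nat r *\<^sub>c series_exp b r v = (\<Sum>k\<le>r. (1 / fact k) *\<^sub>c (of_nat r *\<^sub>c series_pow b k r v))"
    by (simp add: series_exp_def cv.scale_sum_right mult.commute)
  \<comment> \<open>The term \<open>k = 0\<close> vanishes because \<open>r > 0\<close>. After the
    index shift, the factor k + 1 from \<open>series_pow_rec\<close> turns 1/(k+1)! into
    1/k!.\<close>
  also have "\<dots> = (\<Sum>k\<le>r'. (1 / fact (Suc k)) *\<^sub>c (of_nat r *\<^sub>c series_pow b (Suc k) r v))"
    unfolding Suc by (subst sum.atMost_Suc_shift) (simp del: series_pow.simps(2) fact_Suc of_nat_Suc)
  also have "\<dots> = (\<Sum>k\<le>r'. \<Sum>m=1..r. (of_nat m / fact k) *\<^sub>c b m (series_pow b k (r - m) v))"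
  proof (rule sum.cong[OF refl], goal_cases)
    case (1 k)
    have "(1 / fact (Suc k)) * (of_nat (Suc k) * of_nat m) = (of_nat m / fact k :: complex)" for m
      by (simp add: field_simps del: of_nat_Suc)
    then show ?case
      by (subst series_pow_rec[OF lin comm])
        (simp only: cv.scale_sum_right cv.scale_scale)
  qed
  also have "\<dots> = (\<Sum>m=1..r. \<Sum>k\<le>r'. (of_nat m / fact k) *\<^sub>c b m (series_pow b k (r - m) v))"
    by (rule sum.swap)
  also have "\<dots> = (\<Sum>m=1..r. of_nat m *\<^sub>c b m (series_exp b (r - m) v))"
  proof (rule sum.cong[OF refl], goal_cases)
    case (1 m)
    have "(\<Sum>k\<le>r'. (of_nat m / fact k) *\<^sub>c b m (series_pow b k (r - m) v)) =
        (\<Sum>k\<le>r-m. (of_nat m / fact k) *\<^sub>c b m (series_pow b k (r - m) v))"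
      using 1 Suc lin by (intro sum.mono_neutral_right) (auto simp: series_pow_eq_0 cvp.linear_0)
    then show ?case
      using lin by (simp add: series_exp_def cvp.linear_sum cvp.linear_scale cv.scale_sum_right)
  qed
  finally show ?thesis .
qed (simp add: series_exp_def)

lemma series_exp_0 [simp]: "series_exp b 0 v = v"
  by (simp add: series_exp_def)

lemma cscale_of_nat_cancel: "0 < r \<Longrightarrow> of_nat r *\<^sub>c v = of_nat r *\<^sub>c w \<Longrightarrow> v = w"
  by (metis cv.scale_cancel_left of_nat_eq_0_iff less_not_refl)

text \<open>By \<open>series_exp_rec\<close>, the coefficient of order \<open>r > 0\<close> is 1/r
  times a combination of the \<open>b m\<close> applied to coefficients of lower order.\<close>

lemma clinear_series_exp:
  assumes lin: "\<And>m. clinear (b m)" and comm: "\<And>m n v. b m (b n v) = b n (b m v)"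
  shows "clinear (series_exp b r)"
proof (induction r rule: less_induct)
  case (less r)
  show ?case
  proof (cases "r = 0")
    case False
    have L: "clinear (\<lambda>v. \<Sum>m=1..r. of_nat m *\<^sub>c b m (series_exp b (r - m) v))"
      using less False
      by (intro cvp.linear_compose_sum ballI clinear_scaled clinear_compose[OF lin]) auto
    have "series_exp b r = (\<lambda>v. (1 / of_nat r) *\<^sub>c (\<Sum>m=1..r. of_nat m *\<^sub>c b m (series_exp b (r - m) v)))"
      using False by (simp only: series_exp_rec[OF lin comm, symmetric]) simp
    then show ?thesis using clinear_scaled[OF L, of "1 / of_nat r"] by simp
  qed (simp add: cv.linear_ident)
qed

text \<open>If [X, B(x)] is the scalar series c x^t, then [X, exp B(x)] = c x^t exp B(x). The proof
  compares \<open>r\<close> times the two sides by means of \<open>series_exp_rec\<close>.\<close>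

lemma series_exp_commutator:
  assumes lin: "\<And>m. clinear (b m)" and comm: "\<And>m n v. b m (b n v) = b n (b m v)"
    and X: "clinear X" and t: "t > 0"
    and Xb: "\<And>m v. m > 0 \<Longrightarrow> X (b m v) = b m (X v) + (if m = t then c *\<^sub>c v else 0)"
  shows "X (series_exp b r v) =
    series_exp b r (X v) + (if t \<le> r then c *\<^sub>c series_exp b (r - t) v else 0)"
proof (induction r rule: less_induct)
  case (less r)
  let ?E = "series_exp b"
  show ?case
  proof (cases "r = 0")
    case True
    with t show ?thesis by simp
  next
    case False
    have "of_nat r *\<^sub>c X (?E r v) = X (of_nat r *\<^sub>c ?E r v)"
      using X by (simp add: cvp.linear_scale)
    also have "\<dots> = (\<Sum>m=1..r. of_nat m *\<^sub>c X (b m (?E (r - m) v)))"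
      using X by (simp add: series_exp_rec[OF lin comm] cvp.linear_sum cvp.linear_scale)
    also have "\<dots> = (\<Sum>m=1..r. of_nat m *\<^sub>c b m (?E (r - m) (X v))
        + of_nat m *\<^sub>c b m (if m + t \<le> r then c *\<^sub>c ?E (r - m - t) v else 0)
        + (if m = t then of_nat m *\<^sub>c (c *\<^sub>c ?E (r - m) v) else 0))"
    proof (rule sum.cong[OF refl], goal_cases)
      case (1 m)
      then have "X (?E (r - m) v) =
          ?E (r - m) (X v) + (if m + t \<le> r then c *\<^sub>c ?E (r - m - t) v else 0)"
        using False by (subst less.IH) auto
      then show ?case
        using 1 lin by (subst Xb) (auto simp: cvp.linear_add cv.scale_right_distrib cvp.linear_0)
    qed
    also have "\<dots> = of_nat r *\<^sub>c ?E r (X v)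
        + (\<Sum>m=1..r. of_nat m *\<^sub>c b m (if m + t \<le> r then c *\<^sub>c ?E (r - m - t) v else 0))
        + (if t \<le> r then of_nat t *\<^sub>c (c *\<^sub>c ?E (r - t) v) else 0)"
      using t by (simp add: sum.distrib series_exp_rec[OF lin comm])
    also have "(\<Sum>m=1..r. of_nat m *\<^sub>c b m (if m + t \<le> r then c *\<^sub>c ?E (r - m - t) v else 0)) =
        (\<Sum>m=1..r-t. of_nat m *\<^sub>c b m (c *\<^sub>c ?E (r - m - t) v))"
      using t lin by (intro sum.mono_neutral_cong_right) (auto simp: cvp.linear_0)
    also have "\<dots> = c *\<^sub>c (of_nat (r - t) *\<^sub>c ?E (r - t) v)"
      using lin by (simp add: series_exp_rec[OF lin comm] cv.scale_sum_right cvp.linear_scale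
          mult.commute diff_right_commute add.commute)
    \<comment> \<open>The weight \<open>r - t\<close> of the shifted sum and the weight
      \<open>t\<close> of the term \<open>m = t\<close> add up to \<open>r\<close>, which can then
      be cancelled.\<close>
    also have "of_nat r *\<^sub>c ?E r (X v) + c *\<^sub>c (of_nat (r - t) *\<^sub>c ?E (r - t) v)
        + (if t \<le> r then of_nat t *\<^sub>c (c *\<^sub>c ?E (r - t) v) else 0) =
        of_nat r *\<^sub>c (?E r (X v) + (if t \<le> r then c *\<^sub>c ?E (r - t) v else 0))"
      by (auto simp: cv.scale_right_distrib of_nat_diff cv.scale_left_diff_distrib algebra_simps)
    finally show ?thesis using False cscale_of_nat_cancel by blast
  qed
qed

lemma series_exp_commute:
  assumes lin: "\<And>m. clinear (b m)" and comm: "\<And>m n v. b m (b n v) = b n (b m v)"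
    and X: "clinear X" and Xb: "\<And>m v. m > 0 \<Longrightarrow> X (b m v) = b m (X v)"
  shows "X (series_exp b r v) = series_exp b r (X v)"
  using series_exp_commutator[OF lin comm X, where t = 1 and c = 0] Xb by simp

section \<open>Modes of the vertex operators\<close>

definition momc :: "int \<Rightarrow> complex"
  where "momc k = of_real (mom k)"

lemma momc_mult: "momc k * momc l = 2 * of_int k * of_int l"
proof -
  have "mom k * mom l = 2 * of_int k * of_int l" by (simp add: mom_def)
  then show ?thesis
    by (simp only: momc_def of_real_mult[symmetric]) simp
qed

lemma momc_add: "momc (j + k) = momc j + momc k"
  by (simp add: momc_def mom_def algebra_simps)

section \<open>Commutators of the Heisenberg operators with the factors of a vertex operator\<close>

lemma heis_swap: "n + m \<noteq> 0 \<Longrightarrow> heis n (heis m v) = heis m (heis n v)"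
  using heis_commutator[of n m v] by simp

lemma heis_commute: "heis n (heis m v) = heis m (heis n v) + (if n + m = 0 then of_int n *\<^sub>c v else 0)"
  using heis_commutator[of n m v] by (simp add: algebra_simps)

lemma heis_cscale: "heis n (c *\<^sub>c v) = c *\<^sub>c heis n v"
  by (simp add: heis_def lin_ext_cscale)

lemma heis_uminus: "heis n (- v) = - heis n v"
  by (simp add: heis_def lin_ext_uminus)

lemma creation_exp_eq: "creation_exp k = series_exp (\<lambda>m v. (momc k / of_nat m) *\<^sub>c heis (- int m) v)"
  by (simp add: creation_exp_def momc_def)

lemma annihilation_exp_eq:
  "annihilation_exp k = series_exp (\<lambda>m v. (- momc k / of_nat m) *\<^sub>c heis (int m) v)"
  by (simp add: annihilation_exp_def momc_def)

lemma clinear_scaled_heis: "clinear (\<lambda>v. c *\<^sub>c heis n v)"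
  by (intro clinear_scaled clinear_heis)

text \<open>Equal indices are treated separately because for m = n = 0 the indices sum to 0, which
  \<open>heis_swap\<close> excludes.\<close>

lemma heis_same_sign:
  "heis (int m) (heis (int n) v) = heis (int n) (heis (int m) v)"
  "heis (- int m) (heis (- int n) v) = heis (- int n) (heis (- int m) v)"
  by (cases "m = n", simp, rule heis_swap, linarith)+

lemma scaled_heis_comm:
  "c *\<^sub>c heis (int m) (d *\<^sub>c heis (int n) v) = d *\<^sub>c heis (int n) (c *\<^sub>c heis (int m) v)"
  "c *\<^sub>c heis (- int m) (d *\<^sub>c heis (- int n) v) = d *\<^sub>c heis (- int n) (c *\<^sub>c heis (- int m) v)"
  using heis_same_sign[of m n v] by (simp_all add: heis_cscale mult.commute)

lemma clinear_creation_exp: "clinear (creation_exp k r)"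
  and clinear_annihilation_exp: "clinear (annihilation_exp k r)"
  unfolding creation_exp_eq annihilation_exp_eq
  by (intro clinear_series_exp clinear_scaled_heis scaled_heis_comm)+

lemma creation_exp_rec:
  "of_nat r *\<^sub>c creation_exp k r v = momc k *\<^sub>c (\<Sum>m=1..r. heis (- int m) (creation_exp k (r - m) v))"
  unfolding creation_exp_eq series_exp_rec[OF clinear_scaled_heis scaled_heis_comm(2)] cv.scale_sum_right
  by (intro sum.cong) auto

lemma annihilation_exp_rec:
  "of_nat r *\<^sub>c annihilation_exp k r v = (- momc k) *\<^sub>c (\<Sum>m=1..r. heis (int m) (annihilation_exp k (r - m) v))"
  unfolding annihilation_exp_eq series_exp_rec[OF clinear_scaled_heis scaled_heis_comm(1)] cv.scale_sum_right
  by (intro sum.cong) auto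

lemma creation_exp_0 [simp]: "creation_exp k 0 v = v"
  and annihilation_exp_0 [simp]: "annihilation_exp k 0 v = v"
  by (simp_all add: creation_exp_def annihilation_exp_def)

text \<open>The operator a_t meets only the term (mu/t) a_{-t} of the exponent, and [a_t, a_{-t}] =
  t leaves the scalar mu.\<close>

lemma heis_pos_creation_exp:
  assumes "t > 0"
  shows "heis (int t) (creation_exp k r v) =
    creation_exp k r (heis (int t) v) + (if t \<le> r then momc k *\<^sub>c creation_exp k (r - t) v else 0)"
  unfolding creation_exp_eq
proof (rule series_exp_commutator)
  fix m v assume "m > (0::nat)"
  then show "heis (int t) ((momc k / of_nat m) *\<^sub>c heis (- int m) v) =
      (momc k / of_nat m) *\<^sub>c heis (- int m) (heis (int t) v) + (if m = t then momc k *\<^sub>c v else 0)"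
    by (auto simp: heis_cscale heis_uminus heis_uminus heis_commute[of "int t"] cv.scale_right_distrib)
qed (rule clinear_scaled_heis scaled_heis_comm clinear_heis assms)+

text \<open>The scalar is again +mu: the coefficient -mu/t of a_t in the exponent meets
  [a_{-t}, a_t] = -t.\<close>

lemma heis_neg_annihilation_exp:
  assumes "t > 0"
  shows "heis (- int t) (annihilation_exp k r v) =
    annihilation_exp k r (heis (- int t) v) + (if t \<le> r then momc k *\<^sub>c annihilation_exp k (r - t) v else 0)"
  unfolding annihilation_exp_eq
proof (rule series_exp_commutator)
  fix m v assume "m > (0::nat)"
  then show "heis (- int t) ((- momc k / of_nat m) *\<^sub>c heis (int m) v) =
      (- momc k / of_nat m) *\<^sub>c heis (int m) (heis (- int t) v) + (if m = t then momc k *\<^sub>c v else 0)"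
    by (auto simp: heis_cscale heis_uminus heis_uminus heis_commute[of "- int t"] cv.scale_right_distrib)
qed (rule clinear_scaled_heis scaled_heis_comm clinear_heis assms)+

lemma heis_creation_exp_commute: "n \<le> 0 \<Longrightarrow> heis n (creation_exp k r v) = creation_exp k r (heis n v)"
  unfolding creation_exp_eq
  by (rule series_exp_commute, (rule clinear_scaled_heis scaled_heis_comm clinear_heis)+)
    (auto simp: heis_cscale heis_uminus heis_swap)

lemma heis_annihilation_exp_commute:
  "n \<ge> 0 \<Longrightarrow> heis n (annihilation_exp k r v) = annihilation_exp k r (heis n v)"
  unfolding annihilation_exp_eq
  by (rule series_exp_commute, (rule clinear_scaled_heis scaled_heis_comm clinear_heis)+)
    (auto simp: heis_cscale heis_uminus heis_swap)

lemma heis_shift: "heis n (shift k v) = shift k (heis n v) + (if n = 0 then momc k *\<^sub>c shift k v else 0)"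
proof (rule clinear_eqI[where f = "\<lambda>v. heis n (shift k v)"
      and g = "\<lambda>v. shift k (heis n v) + (if n = 0 then momc k *\<^sub>c shift k v else 0)"])
  show "clinear (\<lambda>v. heis n (shift k v))"
    by (rule clinear_compose[OF clinear_heis clinear_shift])
  have "clinear (\<lambda>v. shift k (heis n v) + (if n = 0 then momc k else 0) *\<^sub>c shift k v)"
    by (intro cvp.linear_compose_add clinear_compose[OF clinear_shift clinear_heis] clinear_scaled clinear_shift)
  also have "(\<lambda>v. shift k (heis n v) + (if n = 0 then momc k else 0) *\<^sub>c shift k v) =
      (\<lambda>v. shift k (heis n v) + (if n = 0 then momc k *\<^sub>c shift k v else 0))"
    by auto
  finally show "clinear (\<lambda>v. shift k (heis n v) + (if n = 0 then momc k *\<^sub>c shift k v else 0))" .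
  show "heis n (shift k (Poly_Mapping.single b 1)) = shift k (heis n (Poly_Mapping.single b 1)) +
      (if n = 0 then momc k *\<^sub>c shift k (Poly_Mapping.single b 1) else 0)" for b
    by (cases b) (auto simp: heis_def shift_def lin_ext_single heis_basis_def cscale_single
        momc_add[unfolded momc_def] momc_def single_add add.commute)
qed

lemma heis_zpow: "heis n (zpow_coeff k p v) = zpow_coeff k p (heis n v)"
proof (rule clinear_eqI[where f = "\<lambda>v. heis n (zpow_coeff k p v)"
      and g = "\<lambda>v. zpow_coeff k p (heis n v)"])
  show "heis n (zpow_coeff k p (Poly_Mapping.single b 1)) = zpow_coeff k p (heis n (Poly_Mapping.single b 1))" for b
    by (cases b) (auto simp: heis_def zpow_coeff_def lin_ext_single heis_basis_def cscale_single lin_ext_zero)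
qed (rule clinear_compose[OF clinear_heis clinear_zpow] clinear_compose[OF clinear_zpow clinear_heis])+

section \<open>Linearity of the modes and their commutator with the Heisenberg operators\<close>

lemma clinear_vertex_summand: "clinear (\<lambda>v. vertex_summand k n v rs)"
  unfolding vertex_summand_def
  by (cases rs) (simp add: clinear_compose[OF clinear_shift clinear_compose[OF clinear_zpow
      clinear_compose[OF clinear_creation_exp clinear_annihilation_exp]]])

lemma Sum_any_linear:
  assumes "clinear f" "finite {x. g x \<noteq> 0}"
  shows "f (Sum_any g) = Sum_any (\<lambda>x. f (g x))"
proof -
  have "Sum_any (\<lambda>x. f (g x)) = (\<Sum>x | g x \<noteq> 0. f (g x))"
    using assms by (intro Sum_any.expand_superset) (auto simp: cvp.linear_0)
  also have "\<dots> = f (Sum_any g)"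
    using assms(1) by (simp add: cvp.linear_sum Sum_any.expand_set)
  finally show ?thesis by simp
qed

lemma clinear_vertex_mode: "clinear (vertex_mode k n)"
proof (rule clinearI)
  show "vertex_mode k n (v + w) = vertex_mode k n v + vertex_mode k n w" for v w
    unfolding vertex_mode_def
    by (subst Sum_any.distrib[symmetric, OF finite_vertex_summands finite_vertex_summands])
      (simp add: cvp.linear_add[OF clinear_vertex_summand])
  show "vertex_mode k n (c *\<^sub>c v) = c *\<^sub>c vertex_mode k n v" for c v
    unfolding vertex_mode_def
    using Sum_any_linear[OF clinear_scaled[OF cv.linear_ident] finite_vertex_summands]
    by (simp add: cvp.linear_scale[OF clinear_vertex_summand])
qed

lemma Sum_any_reindex_zero:
  assumes "inj h" "finite {x. g x \<noteq> 0}" "\<And>x. f (h x) = g x" "\<And>y. y \<notin> range h \<Longrightarrow> f y = 0"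
  shows "Sum_any f = Sum_any g"
proof -
  have supp: "{y. f y \<noteq> 0} = h ` {x. g x \<noteq> 0}"
    using assms(3,4) by force
  have "Sum_any f = (\<Sum>y\<in>h ` {x. g x \<noteq> 0}. f y)"
    by (simp add: Sum_any.expand_set supp)
  also have "\<dots> = (\<Sum>x | g x \<noteq> 0. f (h x))"
    by (rule sum.reindex[unfolded o_def]) (use assms(1) in \<open>auto intro: inj_on_subset\<close>)
  finally show ?thesis using assms(3) by (simp add: Sum_any.expand_set)
qed

text \<open>Translating one summation index absorbs the power of z produced by commuting past one of
  the two exponentials.\<close>

lemma Sum_any_shift:
  fixes g :: "nat \<times> nat \<Rightarrow> 'a::comm_monoid_add"
  assumes "finite {x. g x \<noteq> 0}"
  shows "Sum_any (\<lambda>(r, s). if t \<le> s then g (r, s - t) else 0) = Sum_any g" (is ?A)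
    and "Sum_any (\<lambda>(r, s). if t \<le> r then g (r - t, s) else 0) = Sum_any g" (is ?B)
proof -
  have "(r, s) \<in> range (\<lambda>(r, s). (r, s + t))" if "t \<le> s" for r s :: nat
    using that by (intro image_eqI[of _ _ "(r, s - t)"]) auto
  then show ?A
    using assms by (intro Sum_any_reindex_zero[where h = "\<lambda>(r, s). (r, s + t)"])
      (auto simp: inj_on_def simp del: image_iff)
  have "(r, s) \<in> range (\<lambda>(r, s). (r + t, s))" if "t \<le> r" for r s :: nat
    using that by (intro image_eqI[of _ _ "(r - t, s)"]) auto
  then show ?B
    using assms by (intro Sum_any_reindex_zero[where h = "\<lambda>(r, s). (r + t, s)"])
      (auto simp: inj_on_def simp del: image_iff)
qed

text \<open>Exactly one factor of the vertex operator fails to commute with a_m: the annihilation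
  exponential for \<open>m < 0\<close>, the translation e^{mu q} for \<open>m = 0\<close>, the
  creation exponential for \<open>m > 0\<close>. In each case the commutator multiplies the series
  by mu z^m.\<close>

lemma heis_vertex_mode:
  "heis m (vertex_mode k n v) = vertex_mode k n (heis m v) + momc k *\<^sub>c vertex_mode k (n + m) v"
proof -
  let ?S = "vertex_summand k"
  let ?t = "nat \<bar>m\<bar>"
  \<comment> \<open>\<open>g\<close> is the summand of the mode \<open>n + m\<close> with the index
    of the responsible exponential translated by |m|.\<close>
  define g where "g = (\<lambda>(r, s).
     if m < 0 then (if ?t \<le> s then ?S (n + m) v (r, s - ?t) else 0)
     else if m > 0 then (if ?t \<le> r then ?S (n + m) v (r - ?t, s) else 0)
     else ?S (n + m) v (r, s))"
  have fin: "finite {rs. ?S n' v' rs \<noteq> 0}" for n' v' by (rule finite_vertex_summands)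
  have g: "Sum_any g = vertex_mode k (n + m) v"
    using Sum_any_shift[OF fin[of "n + m" v], of ?t]
    by (cases "m = 0"; cases "m < 0") (simp_all add: g_def vertex_mode_def)
  have fing: "finite {rs. g rs \<noteq> 0}"
  proof -
    let ?N = "{rs. ?S (n + m) v rs \<noteq> 0}"
    have "{rs. g rs \<noteq> 0} \<subseteq> (\<lambda>(r, s). (r, s + ?t)) ` ?N \<union> (\<lambda>(r, s). (r + ?t, s)) ` ?N \<union> ?N"
    proof
      fix rs assume "rs \<in> {rs. g rs \<noteq> 0}"
      then obtain r s where rs: "rs = (r, s)" and nz: "g (r, s) \<noteq> 0" by (cases rs) auto
      consider "?t \<le> s" "(r, s - ?t) \<in> ?N" | "?t \<le> r" "(r - ?t, s) \<in> ?N" | "rs \<in> ?N"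
        using nz unfolding g_def rs by (auto split: if_splits)
      then show "rs \<in> (\<lambda>(r, s). (r, s + ?t)) ` ?N \<union> (\<lambda>(r, s). (r + ?t, s)) ` ?N \<union> ?N"
      proof cases
        case 1
        then have "rs \<in> (\<lambda>(r, s). (r, s + ?t)) ` ?N"
          unfolding rs by (intro image_eqI[of _ _ "(r, s - ?t)"]) auto
        then show ?thesis by blast
      next
        case 2
        then have "rs \<in> (\<lambda>(r, s). (r + ?t, s)) ` ?N"
          unfolding rs by (intro image_eqI[of _ _ "(r - ?t, s)"]) auto
        then show ?thesis by blast
      qed blast
    qed
    moreover have "finite \<dots>" using fin by auto
    ultimately show ?thesis by (rule finite_subset)
  qed
  have step: "heis m (?S n v rs) = ?S n (heis m v) rs + momc k *\<^sub>c g rs" for rs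
  proof -
    obtain r s where rs: "rs = (r, s)" by force
    note lins = clinear_shift clinear_zpow clinear_creation_exp clinear_annihilation_exp
    consider "m < 0" | "m = 0" | "m > 0" by linarith
    then show ?thesis
    proof cases
      case 1
      then obtain t where m: "m = - int t" "t > 0" by (metis zero_less_imp_eq_int neg_0_less_iff_less minus_minus of_nat_0_less_iff)
      have "heis m (?S n v rs) = shift k (zpow_coeff k (- n - 1 - int r + int s)
          (creation_exp k r (heis (- int t) (annihilation_exp k s v))))"
        using 1 m(1) by (simp add: rs vertex_summand_def heis_shift heis_zpow heis_creation_exp_commute)
      then show ?thesis
        using 1 m lins[THEN cvp.linear_add] lins[THEN cvp.linear_scale] lins[THEN cvp.linear_0]
        by (simp add: heis_neg_annihilation_exp rs g_def vertex_summand_def algebra_simps)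
    next
      case 2
      then show ?thesis
        by (simp add: rs vertex_summand_def heis_shift heis_zpow heis_creation_exp_commute
            heis_annihilation_exp_commute g_def)
    next
      case 3
      then obtain t where m: "m = int t" "t > 0" by (metis zero_less_imp_eq_int of_nat_0_less_iff)
      have "heis m (?S n v rs) = shift k (zpow_coeff k (- n - 1 - int r + int s)
          (heis (int t) (creation_exp k r (annihilation_exp k s v))))"
        using 3 m(1) by (simp add: rs vertex_summand_def heis_shift heis_zpow)
      then show ?thesis
        using 3 m lins[THEN cvp.linear_add] lins[THEN cvp.linear_scale] lins[THEN cvp.linear_0]
        by (simp add: heis_pos_creation_exp heis_annihilation_exp_commute rs g_def vertex_summand_def algebra_simps)
    qed
  qed
  have "heis m (vertex_mode k n v) = Sum_any (\<lambda>rs. ?S n (heis m v) rs + momc k *\<^sub>c g rs)"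
    unfolding vertex_mode_def by (subst Sum_any_linear[OF clinear_heis fin]) (simp add: step)
  also have "\<dots> = vertex_mode k n (heis m v) + momc k *\<^sub>c Sum_any g"
    unfolding vertex_mode_def Sum_any_linear[OF clinear_scaled[OF cv.linear_ident] fing]
    by (rule Sum_any.distrib[OF fin]) (rule finite_subset[OF _ fing], auto)
  finally show ?thesis by (simp add: g)
qed

section \<open>The grading\<close>

text \<open>The degree of a Fock monomial; the entry \<open>i\<close> stands for a_{-(i+1)} and so
  counts \<open>Suc i\<close>.\<close>

definition wt :: "nat multiset \<Rightarrow> nat"
  where "wt M = sum_mset (image_mset Suc M)"

lemma wt_simps [simp]: "wt {#} = 0" "wt (add_mset i M) = Suc i + wt M" "wt M = 0 \<longleftrightarrow> M = {#}"
  by (auto simp: wt_def)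

text \<open>The degree is an integer, so that operators lowering it need no case distinction; in
  negative degree only 0 is left (\<open>homog_neg\<close>).\<close>

definition homog :: "int \<Rightarrow> int \<Rightarrow> lattice_va set"
  where "homog j d = {v. Poly_Mapping.keys v \<subseteq> {(j', M). j' = j \<and> int (wt M) = d}}"

lemma subspace_homog: "cv.subspace (homog j d)"
proof (rule cv.subspaceI)
  show "v + w \<in> homog j d" if "v \<in> homog j d" "w \<in> homog j d" for v w
    using that keys_add[of v w] unfolding homog_def by blast
  show "c *\<^sub>c v \<in> homog j d" if "v \<in> homog j d" for c v
    using that keys_cscale[of c v] unfolding homog_def by blast
qed (simp add: homog_def)

lemmas homog_zero = cv.subspace_0[OF subspace_homog]
  and homog_add = cv.subspace_add[OF subspace_homog]
  and homog_diff = cv.subspace_diff[OF subspace_homog]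
  and homog_scale = cv.subspace_scale[OF subspace_homog]
  and homog_sum = cv.subspace_sum[OF subspace_homog]

lemma homog_neg: "v \<in> homog j d \<Longrightarrow> d < 0 \<Longrightarrow> v = 0"
  by (force simp: homog_def simp flip: keys_eq_empty)

lemma homog_ket: "ket j \<in> homog j 0"
  by (auto simp: homog_def ket_def)

lemma homog_lin_ext:
  assumes "v \<in> homog j d" "\<And>M. int (wt M) = d \<Longrightarrow> f (j, M) \<in> homog j' d'"
  shows "lin_ext f v \<in> homog j' d'"
  unfolding lin_ext_def
proof (intro homog_sum homog_scale)
  fix b assume "b \<in> Poly_Mapping.keys v"
  with assms show "f b \<in> homog j' d'" by (cases b) (auto simp: homog_def)
qed

lemma homog_heis: "v \<in> homog j d \<Longrightarrow> heis n v \<in> homog j (d - n)"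
  unfolding heis_def
proof (erule homog_lin_ext)
  fix M assume M: "int (wt M) = d"
  have "int (wt (M - {#nat (n - 1)#})) = d - n" if "n > 0" "nat (n - 1) \<in># M"
    using that M by (auto dest!: multi_member_split)
  with M show "heis_basis n (j, M) \<in> homog j (d - n)"
    by (auto simp: heis_basis_def homog_def)
qed

lemma homog_creation_exp:
  assumes "v \<in> homog j d"
  shows "creation_exp k r v \<in> homog j (d + int r)"
proof -
  let ?T = "\<lambda>r. {(j', M). j' = j \<and> int (wt M) = d + int r}"
  have "Poly_Mapping.keys (creation_exp k r v) \<subseteq> ?T (0 + r)"
    unfolding creation_exp_eq
  proof (rule keys_series_exp[where T = ?T])
    fix d' m and v :: lattice_va assume "Poly_Mapping.keys v \<subseteq> ?T d'"
    then have "v \<in> homog j (d + int d')" by (simp add: homog_def)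
    from homog_scale[OF homog_heis[OF this, of "- int m"]]
    show "Poly_Mapping.keys ((momc k / of_nat m) *\<^sub>c heis (- int m) v) \<subseteq> ?T (d' + m)"
      by (simp add: homog_def add.assoc)
  qed (use assms in \<open>simp add: homog_def\<close>)
  then show ?thesis by (simp add: homog_def)
qed

lemma homog_annihilation_exp:
  assumes "v \<in> homog j d"
  shows "annihilation_exp k s v \<in> homog j (d - int s)"
proof -
  let ?T = "\<lambda>s. {(j', M). j' = j \<and> int (wt M) = d - int s}"
  have "Poly_Mapping.keys (annihilation_exp k s v) \<subseteq> ?T (0 + s)"
    unfolding annihilation_exp_eq
  proof (rule keys_series_exp[where T = ?T])
    fix d' m and v :: lattice_va assume "Poly_Mapping.keys v \<subseteq> ?T d'"
    then have "v \<in> homog j (d - int d')" by (simp add: homog_def)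
    from homog_scale[OF homog_heis[OF this, of "int m"]]
    show "Poly_Mapping.keys ((- momc k / of_nat m) *\<^sub>c heis (int m) v) \<subseteq> ?T (d' + m)"
      unfolding homog_def by (simp add: diff_diff_eq)
  qed (use assms in \<open>simp add: homog_def\<close>)
  then show ?thesis by (simp add: homog_def)
qed

lemma homog_shift: "v \<in> homog j d \<Longrightarrow> shift k v \<in> homog (j + k) d"
  unfolding shift_def by (erule homog_lin_ext) (auto simp: homog_def)

text \<open>On vectors of charge \<open>j\<close> the operator z^{mu a_0} is the single power
  z^{2kj}.\<close>

lemma zpow_homog:
  assumes "v \<in> homog j d"
  shows "zpow_coeff k p v = (if p = 2 * k * j then v else 0)"
proof -
  have "mom k * mom j = of_int (2 * k * j)" by (simp add: mom_def)
  then have eq: "mom k * mom j = of_int p \<longleftrightarrow> p = 2 * k * j" by (metis of_int_eq_iff)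
  have "zpow_coeff k p v = (\<Sum>b\<in>Poly_Mapping.keys v. if p = 2 * k * j
      then Poly_Mapping.single b (Poly_Mapping.lookup v b) else 0)"
    unfolding zpow_coeff_def lin_ext_def using assms
  proof (intro sum.cong refl)
    fix b assume "b \<in> Poly_Mapping.keys v"
    then obtain M where "b = (j, M)" using assms by (force simp: homog_def)
    then show "Poly_Mapping.lookup v b *\<^sub>c
        (case b of (j, M) \<Rightarrow> if mom k * mom j = of_int p then Poly_Mapping.single (j, M) 1 else 0) =
        (if p = 2 * k * j then Poly_Mapping.single b (Poly_Mapping.lookup v b) else 0)"
      by (simp add: eq cscale_single cscale_zero)
  qed
  also have "\<dots> = (if p = 2 * k * j then v else 0)"
    by (auto intro!: poly_mapping_eqI simp: lookup_sum lookup_single when_def in_keys_iff)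
  finally show ?thesis .
qed

text \<open>The creation part raises the degree by \<open>r\<close> and the annihilation part lowers
  it by \<open>s\<close>. In every surviving summand r - s = -n - 1 - 2kj, so all of them have the
  same degree.\<close>

lemma homog_vertex_mode:
  assumes "v \<in> homog j d"
  shows "vertex_mode k n v \<in> homog (j + k) (d - n - 1 - 2 * k * j)"
  unfolding vertex_mode_def Sum_any.expand_set
proof (rule homog_sum)
  fix rs :: "nat \<times> nat"
  obtain r s where rs: "rs = (r, s)" by force
  have "creation_exp k r (annihilation_exp k s v) \<in> homog j (d - int s + int r)"
    by (intro homog_creation_exp homog_annihilation_exp assms)
  moreover from this have "creation_exp k r (annihilation_exp k s v) \<in> homog j (d - n - 1 - 2 * k * j)"
    if "- n - 1 - int r + int s = 2 * k * j"
  proof -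
    from that have "d - int s + int r = d - n - 1 - 2 * k * j" by linarith
    with \<open>creation_exp k r _ \<in> _\<close> show ?thesis by simp
  qed
  ultimately show "vertex_summand k n v rs \<in> homog (j + k) (d - n - 1 - 2 * k * j)"
    unfolding rs vertex_summand_def
    by (auto simp: zpow_homog homog_shift homog_zero cvp.linear_0[OF clinear_shift])
qed

section \<open>Primary vectors and detection of zero\<close>

lemma lookup_heis_pos:
  "Poly_Mapping.lookup (heis (int i + 1) v) (j, M) =
    of_nat (i + 1) * of_nat (count M i + 1) * Poly_Mapping.lookup v (j, add_mset i M)"
proof -
  let ?b = "(j, add_mset i M)"
  have "Poly_Mapping.lookup v b * Poly_Mapping.lookup (heis_basis (int i + 1) b) (j, M) =
      (if b = ?b then of_nat (i + 1) * of_nat (count M i + 1) * Poly_Mapping.lookup v ?b else 0)" for b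
  proof -
    obtain j' M' where b: "b = (j', M')" by force
    \<comment> \<open>If \<open>i\<close> is not in \<open>M'\<close>, then
      \<open>M' - {#i#}\<close> is just \<open>M'\<close>, but the factor \<open>count M' i\<close>
      is 0. So only \<open>add_mset i M\<close> contributes.\<close>
    have "M' - {#i#} = M \<and> i \<in># M' \<longleftrightarrow> M' = add_mset i M" by auto
    then show ?thesis
      by (auto simp: b heis_basis_def lookup_single when_def not_in_iff add.commute)
  qed
  then show ?thesis
    by (simp add: heis_def lin_ext_def lookup_sum in_keys_iff)
qed

text \<open>If a monomial of the support contained an entry \<open>i\<close>, then a_{i+1} would
  send it to a monomial with nonzero coefficient, since no other monomial has the same
  image.\<close>

lemma primary_keys:
  assumes "\<And>m. m > 0 \<Longrightarrow> heis m v = 0" "(j, M) \<in> Poly_Mapping.keys v"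
  shows "M = {#}"
proof (rule ccontr)
  assume "M \<noteq> {#}"
  then obtain i M' where M: "M = add_mset i M'" by (metis multiset_cases)
  have "Poly_Mapping.lookup (heis (int i + 1) v) (j, M') = 0" using assms(1) by simp
  then have "Poly_Mapping.lookup v (j, M) = 0"
    unfolding lookup_heis_pos M mult_eq_0_iff of_nat_eq_0_iff by simp
  with assms(2) show False by (simp add: in_keys_iff)
qed

lemma primary_homog_eq_0:
  assumes "\<And>m. m > 0 \<Longrightarrow> heis m v = 0" "v \<in> homog j d" "d \<noteq> 0"
  shows "v = 0"
  using assms(2,3) primary_keys[OF assms(1)] by (force simp: homog_def simp flip: keys_eq_empty)

lemma fock_induct [case_names ket heis add scale]:
  assumes ket: "\<And>j. P (ket j)" and heis: "\<And>i v. P v \<Longrightarrow> P (heis (- int i - 1) v)"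
    and add: "\<And>v w. P v \<Longrightarrow> P w \<Longrightarrow> P (v + w)" and scale: "\<And>c v. P v \<Longrightarrow> P (c *\<^sub>c v)"
  shows "P v"
proof -
  have basis: "P (Poly_Mapping.single b c)" for b c
  proof -
    obtain j M where b: "b = (j, M)" by force
    have "P (Poly_Mapping.single (j, M) 1)"
    proof (induction M)
      case empty
      then show ?case using ket[of j] by (simp add: ket_def)
    next
      case (add i M)
      then show ?case using heis[of "Poly_Mapping.single (j, M) 1" i] by (simp add: heis_single)
    qed
    from scale[OF this, of c] show ?thesis by (simp add: b cscale_single)
  qed
  have zero: "P 0" using scale[OF ket, of 0] by simp
  have "P (\<Sum>b\<in>B. Poly_Mapping.single b (Poly_Mapping.lookup v b))" if "finite B" for B
    using that by induction (auto simp: zero add basis)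
  moreover have "v = (\<Sum>b\<in>Poly_Mapping.keys v. Poly_Mapping.single b (Poly_Mapping.lookup v b))"
    by (intro poly_mapping_eqI) (auto simp: lookup_sum lookup_single when_def in_keys_iff)
  ultimately show ?thesis by (metis finite_keys)
qed

text \<open>
  The positive Heisenberg modes detect vectors of nonzero degree, and the negative ones create
  everything from the vectors \<open>ket j\<close>; so such a family is determined by the components of
  degree 0 of \<open>D n m (ket j)\<close>.
\<close>

lemma graded_family_eq_0:
  fixes D :: "int \<Rightarrow> int \<Rightarrow> lattice_va \<Rightarrow> lattice_va"
  assumes lin: "\<And>n m. clinear (D n m)"
    and comm: "\<And>p n m v. heis p (D n m v) = D n m (heis p v) + \<alpha> *\<^sub>c D (n + p) m v + \<beta> *\<^sub>c D n (m + p) v"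
    and hom: "\<And>n m j. D n m (ket j) \<in> homog (J j) (N j - n - m)"
    and vac: "\<And>n m j. n + m = N j \<Longrightarrow> D n m (ket j) = 0"
  shows "D n m v = 0"
proof -
  have kets: "D n m (ket j) = 0" for n m j
  proof (induction "nat (N j - n - m)" arbitrary: n m rule: less_induct)
    case less
    consider "N j - n - m < 0" | "N j - n - m = 0" | "N j - n - m > 0" by linarith
    then show ?case
    proof cases
      case 1
      then show ?thesis using homog_neg[OF hom] by blast
    next
      case 2
      then show ?thesis by (intro vac) simp
    next
      case 3
      \<comment> \<open>As a_p kills the ket, only the families at (n+p, m) and (n, m+p) remain.
        Their degrees are smaller, so they vanish by induction.\<close>
      have "heis p (D n m (ket j)) = 0" if "p > 0" for p
        using that 3 lin by (simp add: comm heis_pos_ket cvp.linear_0 less)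
      with 3 hom show ?thesis by (intro primary_homog_eq_0[of "D n m (ket j)"]) auto
    qed
  qed
  show ?thesis
  proof (induction v arbitrary: n m rule: fock_induct)
    case (heis i v)
    \<comment> \<open>The induction hypothesis holds for all \<open>n\<close> and \<open>m\<close>,
      so it also removes the two terms with shifted indices.\<close>
    show ?case
      using comm[of "- int i - 1" n m v] by (simp add: heis cvp.linear_0[OF clinear_heis])
  qed (use lin kets in \<open>simp_all add: cvp.linear_add cvp.linear_scale\<close>)
qed

section \<open>Vacuum coefficients and commutators\<close>

text \<open>The coefficient of \<open>x\<^bsup>s\<^esup>\<close> in \<open>(1 - x)\<^bsup>2kl\<^esup>\<close>.\<close>

definition vcoeff :: "int \<Rightarrow> int \<Rightarrow> nat \<Rightarrow> complex"
  where "vcoeff k l s = (- 1) ^ s * (of_int (2 * k * l) gchoose s)"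

text \<open>Coefficient form of x y' = -a (x / (1 - x)) y for y = (1 - x)^a with a = 2kl; dividing
  by 1 - x produces the partial sums.\<close>

lemma vcoeff_rec: "of_nat s * vcoeff k l s = - (of_int (2 * k * l) * (\<Sum>i<s. vcoeff k l i))"
proof (cases s)
  case (Suc t)
  let ?a = "of_int (2 * k * l) :: complex"
  have "(\<Sum>i<s. vcoeff k l i) = (- 1) ^ t * (?a - 1 gchoose t)"
    using gbinomial_sum_lower_neg[of ?a t] by (simp add: Suc lessThan_Suc_atMost vcoeff_def mult.commute)
  moreover have "of_nat s * (?a gchoose s) = ?a * (?a - 1 gchoose t)"
    using gbinomial_absorption[of t ?a] by (simp add: Suc)
  ultimately show ?thesis by (simp add: vcoeff_def Suc mult_ac)
qed simp

lemma heis_pos_creation_exp_ket: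
  "t > 0 \<Longrightarrow> heis (int t) (creation_exp k r (ket j)) =
    (if t \<le> r then momc k *\<^sub>c creation_exp k (r - t) (ket j) else 0)"
  by (simp add: heis_pos_creation_exp heis_pos_ket cvp.linear_0[OF clinear_creation_exp])

text \<open>Normal ordering: moving the annihilation exponential past the creation exponential costs
  the factor (1 - x)^{2kl}, after which it acts as 1 on the ket. Both sides satisfy the recursion of
  \<open>vcoeff_rec\<close> in \<open>s\<close>.\<close>

lemma annihilation_creation_ket:
  "annihilation_exp k s (creation_exp l r (ket j)) =
    (if s \<le> r then vcoeff k l s *\<^sub>c creation_exp l (r - s) (ket j) else 0)"
proof (induction s rule: less_induct)
  case (less s)
  let ?C = "\<lambda>r. creation_exp l r (ket j)"
  show ?case
  proof (cases "s = 0")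
    case False
    have "heis (int m) (annihilation_exp k (s - m) (?C r)) =
        (if s \<le> r then (vcoeff k l (s - m) * momc l) *\<^sub>c ?C (r - s) else 0)" if "m \<in> {1..s}" for m
    proof -
      have "r - (s - m) - m = r - s" using that by auto
      then show ?thesis
        using that by (subst less.IH)
          (auto simp: heis_cscale heis_pos_creation_exp_ket cvp.linear_0[OF clinear_heis])
    qed
    then have "of_nat s *\<^sub>c annihilation_exp k s (?C r) =
        (- momc k) *\<^sub>c (\<Sum>m=1..s. if s \<le> r then (vcoeff k l (s - m) * momc l) *\<^sub>c ?C (r - s) else 0)"
      unfolding annihilation_exp_rec by simp
    also have "\<dots> = (if s \<le> r then (- (momc k * momc l) * (\<Sum>m=1..s. vcoeff k l (s - m))) *\<^sub>c ?C (r - s) else 0)"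
      by (simp add: cv.scale_sum_left[symmetric] sum_distrib_left sum_negf mult_ac)
    also have "(\<Sum>m=1..s. vcoeff k l (s - m)) = (\<Sum>i<s. vcoeff k l i)"
      by (simp add: sum.atLeast1_atMost_eq sum.nat_diff_reindex)
    also have "- (momc k * momc l) * (\<Sum>i<s. vcoeff k l i) = of_nat s * vcoeff k l s"
      by (simp add: vcoeff_rec momc_mult)
    finally have "of_nat s *\<^sub>c annihilation_exp k s (?C r) =
        of_nat s *\<^sub>c (if s \<le> r then vcoeff k l s *\<^sub>c ?C (r - s) else 0)" by auto
    with False show ?thesis using cscale_of_nat_cancel by blast
  qed (simp add: vcoeff_def)
qed

lemma creation_exp_shift: "shift l (creation_exp k r v) = creation_exp k r (shift l v)"
  unfolding creation_exp_eq
  by (rule series_exp_commute, (rule clinear_scaled_heis scaled_heis_comm clinear_shift)+)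
    (simp add: heis_shift cvp.linear_scale[OF clinear_shift])

lemma Sum_any_single: "(\<And>x. x \<noteq> a \<Longrightarrow> f x = 0) \<Longrightarrow> Sum_any f = f a"
  by (subst Sum_any.expand_superset[of "{a}"]) auto

lemma vertex_summand_creation_ket:
  "vertex_summand k n (creation_exp l r (ket j)) (r', s) =
    (if s \<le> r \<and> - n - 1 - int r' + int s = 2 * k * j
     then vcoeff k l s *\<^sub>c creation_exp k r' (creation_exp l (r - s) (ket (j + k))) else 0)"
proof -
  have "creation_exp k r' (creation_exp l (r - s) (ket j)) \<in> homog j (0 + int (r - s) + int r')"
    by (intro homog_creation_exp homog_ket)
  then show ?thesis
    by (simp add: vertex_summand_def annihilation_creation_ket zpow_homog[OF homog_scale] creation_exp_shift
        shift_ket cvp.linear_0[OF clinear_shift] cvp.linear_0[OF clinear_zpow]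
        cvp.linear_0[OF clinear_creation_exp] cvp.linear_scale[OF clinear_shift]
        cvp.linear_scale[OF clinear_creation_exp])
qed

lemma vertex_mode_ket:
  "vertex_mode k n (ket j) =
    (if - n - 1 - 2 * k * j \<ge> 0 then creation_exp k (nat (- n - 1 - 2 * k * j)) (ket (j + k)) else 0)"
proof -
  have S: "vertex_summand k n (ket j) (r, s) =
     (if s = 0 \<and> - n - 1 - int r = 2 * k * j then creation_exp k r (ket (j + k)) else 0)" for r s
    \<comment> \<open>The ket is read as the coefficient of order 0 of a creation exponential, whose
      parameter 1 is arbitrary.\<close>
    using vertex_summand_creation_ket[of k n 1 0 j r s] by (auto simp: vcoeff_def)
  have "vertex_mode k n (ket j) = vertex_summand k n (ket j) (nat (- n - 1 - 2 * k * j), 0)"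
    unfolding vertex_mode_def by (rule Sum_any_single) (auto simp: S split: if_splits)
  then show ?thesis by (auto simp: S)
qed

text \<open>The assumption says that the mode lowers the degree by exactly \<open>r\<close>. All
  \<open>r\<close> units must then be removed by the annihilation part, which leaves the summand (0,
  r).\<close>

lemma vertex_mode_creation_ket:
  assumes "- n - 1 - 2 * k * j = - int r"
  shows "vertex_mode k n (creation_exp l r (ket j)) = vcoeff k l r *\<^sub>c ket (j + k)"
proof -
  have "vertex_mode k n (creation_exp l r (ket j)) = vertex_summand k n (creation_exp l r (ket j)) (0, r)"
    unfolding vertex_mode_def
    by (rule Sum_any_single) (use assms in \<open>auto simp: vertex_summand_creation_ket split: if_splits\<close>)
  then show ?thesis using assms by (simp add: vertex_summand_creation_ket)
qed

text \<open>The value of \<open>n + m\<close> puts the result in degree 0, hence on the line of a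
  ket. If the index \<open>r\<close> is negative, the inner mode already kills the ket.\<close>

lemma vertex_mode_vertex_mode_ket:
  assumes "n + m = - 2 - 2 * k * j - 2 * l * j - 2 * k * l"
  shows "vertex_mode k n (vertex_mode l m (ket j)) =
    (let r = - m - 1 - 2 * l * j in if r \<ge> 0 then vcoeff k l (nat r) else 0) *\<^sub>c ket (j + k + l)"
proof (cases "- m - 1 - 2 * l * j \<ge> 0")
  case True
  then have "- n - 1 - 2 * k * (j + l) = - int (nat (- m - 1 - 2 * l * j))"
    using assms by (simp add: algebra_simps)
  with True show ?thesis by (simp add: vertex_mode_ket vertex_mode_creation_ket ac_simps)
qed (simp add: vertex_mode_ket cvp.linear_0[OF clinear_vertex_mode])

lemma homog_vertex_mode2:
  "vertex_mode k n (vertex_mode l m (ket j)) \<in> homog (j + k + l) (- 2 - 2 * k * j - 2 * l * j - 2 * k * l - n - m)"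
proof -
  have "vertex_mode k n (vertex_mode l m (ket j)) \<in>
      homog (j + l + k) (0 - m - 1 - 2 * l * j - n - 1 - 2 * k * (j + l))"
    by (intro homog_vertex_mode homog_ket)
  moreover have "0 - m - 1 - 2 * l * j - n - 1 - 2 * k * (j + l) =
      - 2 - 2 * k * j - 2 * l * j - 2 * k * l - n - m"
    by (simp add: algebra_simps)
  moreover have "j + l + k = j + k + l" by simp
  ultimately show ?thesis by metis
qed

section \<open>Commutation relations of the modes of e and f\<close>

lemma clinear_vertex_mode2: "clinear (\<lambda>v. vertex_mode k n (vertex_mode l m v))"
  by (rule clinear_compose[OF clinear_vertex_mode clinear_vertex_mode])

lemma heis_vertex_mode2:
  "heis p (vertex_mode k n (vertex_mode l m v)) = vertex_mode k n (vertex_mode l m (heis p v)) +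
    momc k *\<^sub>c vertex_mode k (n + p) (vertex_mode l m v) +
    momc l *\<^sub>c vertex_mode k n (vertex_mode l (m + p) v)"
  by (simp add: heis_vertex_mode cvp.linear_add[OF clinear_vertex_mode] cvp.linear_scale[OF clinear_vertex_mode])

text \<open>The cases k = 1 and k = -1 are those of e and f. The vacuum coefficients are 1, -2, 1
  from (1 - x)^2, and exchanging the two modes replaces the index r by 2 - r, which preserves
  them.\<close>

lemma vertex_mode_commute:
  assumes "k * k = 1"
  shows "vertex_mode k n (vertex_mode k m v) = vertex_mode k m (vertex_mode k n v)"
proof -
  define c where "c = (\<lambda>r. if r \<ge> 0 then vcoeff k k (nat r) else 0)"
  have kk: "2 * k * k = 2" using assms by simp
  have vc: "vcoeff k k s = (- 1) ^ s * of_nat (2 choose s)" for s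
    by (simp only: vcoeff_def kk binomial_gbinomial) simp
  have sym: "c r = c (2 - r)" for r
  proof -
    consider "r < 0" | "r = 0" | "r = 1" | "r = 2" | "r > 2" by linarith
    then show ?thesis
      by cases (auto simp: c_def vc binomial_eq_0 numeral_2_eq_2)
  qed
  have "(\<lambda>n m v. vertex_mode k n (vertex_mode k m v) - vertex_mode k m (vertex_mode k n v)) n m v = 0"
  proof (rule graded_family_eq_0[where D =
        "\<lambda>n m v. vertex_mode k n (vertex_mode k m v) - vertex_mode k m (vertex_mode k n v)" and \<alpha> = "momc k" and \<beta> = "momc k" and J = "\<lambda>j. j + k + k"
        and N = "\<lambda>j. - 2 - 2 * k * j - 2 * k * j - 2 * k * k"])
    show "vertex_mode k n (vertex_mode k m (ket j)) - vertex_mode k m (vertex_mode k n (ket j)) = 0"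
      if "n + m = - 2 - 2 * k * j - 2 * k * j - 2 * k * k" for n m j
    proof -
      have "- n - 1 - 2 * k * j = 2 - (- m - 1 - 2 * k * j)" using that kk by linarith
      then have "c (- n - 1 - 2 * k * j) = c (- m - 1 - 2 * k * j)" using sym by metis
      then show ?thesis
        using that vertex_mode_vertex_mode_ket[of n m k j k] vertex_mode_vertex_mode_ket[of m n k j k]
        by (simp add: c_def Let_def add.commute)
    qed
    show "vertex_mode k n (vertex_mode k m (ket j)) - vertex_mode k m (vertex_mode k n (ket j))
      \<in> homog (j + k + k) (- 2 - 2 * k * j - 2 * k * j - 2 * k * k - n - m)" for n m j
      using homog_vertex_mode2[of k n k m j] homog_vertex_mode2[of k m k n j]
      by (intro homog_diff) (simp_all add: algebra_simps)
  qed (auto intro: cvp.linear_compose_sub clinear_vertex_mode2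
      simp: heis_vertex_mode2 cvp.linear_diff[OF clinear_heis] cv.scale_right_diff_distrib)
  then show ?thesis by simp
qed

lemma e_f_commutator:
  "vertex_mode 1 n (vertex_mode (- 1) m v) - vertex_mode (- 1) m (vertex_mode 1 n v) =
    momc 1 *\<^sub>c heis (n + m) v + (if n = - m then of_int n *\<^sub>c v else 0)"
proof -
  \<comment> \<open>The condition stands inside the scalar, so that \<open>R n m\<close> is visibly
    linear in the vector.\<close>
  define R where "R = (\<lambda>n m v. momc 1 *\<^sub>c heis (n + m) v + (if n + m = 0 then of_int n else 0) *\<^sub>c v)"
  let ?V = "vertex_mode 1" and ?V' = "vertex_mode (- 1)"
  have momc_minus: "momc (- 1) = - momc 1" by (simp add: momc_def mom_def)
  have linR: "clinear (R n m)" for n m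
    unfolding R_def by (intro cvp.linear_compose_add clinear_scaled clinear_heis cv.linear_ident)
  \<comment> \<open>With momc (-1) = -momc 1, the Heisenberg parts of the two shifted copies of
    \<open>R\<close> cancel, while their central parts differ by (n + p) - n = p, the scalar in the
    Heisenberg commutator.\<close>
  have heis_R: "heis p (R n m v) = R n m (heis p v) + momc 1 *\<^sub>c R (n + p) m v + momc (- 1) *\<^sub>c R n (m + p) v"
    for p n m v
    using heis_commute[of p "n + m" v]
    by (auto simp: R_def momc_minus cvp.linear_add[OF clinear_heis] heis_cscale algebra_simps
        cvp.linear_0[OF clinear_heis])
  have vc: "vcoeff 1 (- 1) s = of_nat (s + 1)" "vcoeff (- 1) 1 s = of_nat (s + 1)" for s
  proof -
    have "(- 2 gchoose s) = (- 1) ^ s * (of_nat (s + 1) :: complex)"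
      using gbinomial_minus[of "2 :: complex" s] binomial_gbinomial[of "s + 1" s, where 'a = complex]
      by (simp add: add.commute)
    then show "vcoeff 1 (- 1) s = of_nat (s + 1)" "vcoeff (- 1) 1 s = of_nat (s + 1)"
      by (simp_all add: vcoeff_def flip: power_mult_distrib)
  qed
  have "(\<lambda>n m v. ?V n (?V' m v) - ?V' m (?V n v) - R n m v) n m v = 0"
  proof (rule graded_family_eq_0[where D = "\<lambda>n m v. ?V n (?V' m v) - ?V' m (?V n v) - R n m v"
        and \<alpha> = "momc 1" and \<beta> = "momc (- 1)" and J = "\<lambda>j. j" and N = "\<lambda>j. 0"])
    show "?V n (?V' m (ket j)) - ?V' m (?V n (ket j)) - R n m (ket j) = 0" if "n + m = 0" for n m j
    proof -
      have m: "m = - n" using that by simp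
      \<comment> \<open>\<open>t\<close> is the eigenvalue 2j of h_0 plus the central term
        \<open>n\<close>. The coefficients s + 1 of (1 - x)^{-2} give \<open>t\<close> for the first
        product if t >= 1 and \<open>-t\<close> for the second if t <= -1, so the difference is
        always \<open>t\<close>.\<close>
      define t where "t = 2 * j + n"
      have "?V n (?V' m (ket j)) = (if t \<ge> 1 then of_int t else 0) *\<^sub>c ket j"
        using vertex_mode_vertex_mode_ket[of n m 1 j "- 1"] by (auto simp: m Let_def vc t_def)
      moreover have "?V' m (?V n (ket j)) = (if t \<le> - 1 then - of_int t else 0) *\<^sub>c ket j"
        using vertex_mode_vertex_mode_ket[of m n "- 1" j 1] by (auto simp: m Let_def vc t_def)
      moreover have "R n m (ket j) = of_int t *\<^sub>c ket j"
        using momc_mult[of 1 j]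
        by (simp add: R_def m t_def heis_zero_ket cv.scale_left_distrib flip: momc_def)
      ultimately show ?thesis
        by (cases t "0 :: int" rule: linorder_cases) auto
    qed
    show "?V n (?V' m (ket j)) - ?V' m (?V n (ket j)) - R n m (ket j) \<in> homog j (0 - n - m)" for n m j
    proof (intro homog_diff)
      show "?V n (?V' m (ket j)) \<in> homog j (0 - n - m)"
        using homog_vertex_mode2[of 1 n "- 1" m j] by simp
      have "?V' m (?V n (ket j)) \<in> homog j (- m - n)"
        using homog_vertex_mode2[of "- 1" m 1 n j] by simp
      moreover have "- m - n = 0 - n - m" by simp
      ultimately show "?V' m (?V n (ket j)) \<in> homog j (0 - n - m)" by metis
      show "R n m (ket j) \<in> homog j (0 - n - m)"
        unfolding R_def
      proof (rule homog_add)
        have "heis (n + m) (ket j) \<in> homog j (0 - (n + m))" by (intro homog_heis homog_ket)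
        then show "momc 1 *\<^sub>c heis (n + m) (ket j) \<in> homog j (0 - n - m)"
          by (intro homog_scale) (simp add: diff_diff_eq)
        show "(if n + m = 0 then of_int n else 0) *\<^sub>c ket j \<in> homog j (0 - n - m)"
        proof (cases "n + m = 0")
          case True
          then have "0 - n - m = 0" by simp
          then show ?thesis by (simp only: homog_scale homog_ket)
        qed (simp add: homog_zero)
      qed
    qed
  qed (intro cvp.linear_compose_sub clinear_vertex_mode2 linR,
      simp add: heis_vertex_mode2 heis_R cvp.linear_diff[OF clinear_heis] cv.scale_right_diff_distrib)
  then show ?thesis by (auto simp: R_def)
qed

section \<open>The module structure\<close>

lemma momc_1: "momc 1 = of_real (sqrt 2)" "momc 1 * momc 1 = 2" "momc 1 \<noteq> 0"
  and momc_minus_1: "momc (- 1) = - momc 1"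
  using momc_mult[of 1 1] by (auto simp: momc_def mom_def)

lemma clinear_gen_action: "clinear (gen_action g)"
proof (cases g)
  case (E n)
  then have "gen_action g = vertex_mode 1 n" by (auto simp: e_mode_def)
  then show ?thesis by (simp add: clinear_vertex_mode)
next
  case (F n)
  then have "gen_action g = vertex_mode (- 1) n" by (auto simp: f_mode_def)
  then show ?thesis by (simp add: clinear_vertex_mode)
next
  case (H n)
  then have "gen_action g = (\<lambda>v. of_real (sqrt 2) *\<^sub>c heis n v)" by auto
  then show ?thesis by (simp add: clinear_scaled clinear_heis)
next
  case K
  then have "gen_action g = (\<lambda>v. v)" by auto
  then show ?thesis by (simp add: cv.linear_ident)
qed

lemma affine_action_gen: "affine_action (gen g) v = gen_action g v"
  by (simp add: affine_action_def lin_ext_single)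

lemma clinear_affine_action: "clinear (affine_action x)" "clinear (\<lambda>x. affine_action x v)"
  unfolding affine_action_def
  by (simp_all add: lin_ext_def[of _ x] cvp.linear_compose_sum clinear_scaled clinear_gen_action clinear_lin_ext)

lemma affine_action_gen_bracket:
  "affine_action (gen_bracket g h) v = gen_action g (gen_action h v) - gen_action h (gen_action g v)"
proof -
  \<comment> \<open>This covers [h, e] and [h, f] together, since momc 1 * momc k is 2 for k = 1 and
    -2 for k = -1.\<close>
  have HV: "momc 1 *\<^sub>c heis n (vertex_mode k m v) - vertex_mode k m (momc 1 *\<^sub>c heis n v) =
      (momc 1 * momc k) *\<^sub>c vertex_mode k (n + m) v" for n m k
    by (simp add: heis_vertex_mode cv.scale_right_distrib cvp.linear_scale[OF clinear_vertex_mode] add.commute)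
  have VH: "vertex_mode k m (momc 1 *\<^sub>c heis n v) - momc 1 *\<^sub>c heis n (vertex_mode k m v) =
      - ((momc 1 * momc k) *\<^sub>c vertex_mode k (n + m) v)" for n m k
    using HV[of n k m] by (metis minus_diff_eq)
  have FE: "vertex_mode (- 1) m (vertex_mode 1 n v) - vertex_mode 1 n (vertex_mode (- 1) m v) =
      - (momc 1 *\<^sub>c heis (n + m) v + (if n = - m then of_int n *\<^sub>c v else 0))" for n m
    using e_f_commutator[of n m v] by (metis minus_diff_eq)
  have HH: "momc 1 *\<^sub>c heis n (momc 1 *\<^sub>c heis m v) - momc 1 *\<^sub>c heis m (momc 1 *\<^sub>c heis n v) =
      (if n = - m then (2 * of_int n) *\<^sub>c v else 0)" for n m
  proof -
    have "momc 1 *\<^sub>c heis n (momc 1 *\<^sub>c heis m v) - momc 1 *\<^sub>c heis m (momc 1 *\<^sub>c heis n v) =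
        2 *\<^sub>c (heis n (heis m v) - heis m (heis n v))"
      by (simp add: heis_cscale momc_1(2) cv.scale_right_diff_distrib)
    also have "\<dots> = (if n = - m then (2 * of_int n) *\<^sub>c v else 0)"
      unfolding heis_commutator by (simp add: eq_neg_iff_add_eq_0)
    finally show ?thesis .
  qed
  show ?thesis
    unfolding affine_action_def
    by (cases g; cases h)
      (simp_all add: lin_ext_add lin_ext_cscale lin_ext_single lin_ext_zero lin_ext_uminus lin_ext_diff
        e_mode_def f_mode_def vertex_mode_commute HV VH FE HH e_f_commutator momc_1(2) momc_minus_1
        flip: momc_1(1))
qed

text \<open>Both sides are linear in \<open>x\<close> and in \<open>y\<close>, so the relations
  between generators suffice.\<close>

lemma affine_action_bracket:
  "affine_action (lie_bracket x y) v =
    affine_action x (affine_action y v) - affine_action y (affine_action x v)"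
proof (rule clinear_eqI[where v = x and f = "\<lambda>x. affine_action (lie_bracket x y) v"
      and g = "\<lambda>x. affine_action x (affine_action y v) - affine_action y (affine_action x v)"])
  have "clinear (\<lambda>x. lie_bracket x y)" unfolding lie_bracket_def by (rule clinear_lin_ext)
  from clinear_compose[OF clinear_affine_action(2) this]
  show "clinear (\<lambda>x. affine_action (lie_bracket x y) v)" .
  show "clinear (\<lambda>x. affine_action x (affine_action y v) - affine_action y (affine_action x v))"
    by (intro cvp.linear_compose_sub clinear_affine_action(2)
        clinear_compose[OF clinear_affine_action(1) clinear_affine_action(2)])
next
  fix g
  have "affine_action (lin_ext (gen_bracket g) y) v =
      gen_action g (affine_action y v) - affine_action y (gen_action g v)"
  proof (rule clinear_eqI[where v = y and f = "\<lambda>y. affine_action (lin_ext (gen_bracket g) y) v"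
      and g = "\<lambda>y. gen_action g (affine_action y v) - affine_action y (gen_action g v)"])
    show "clinear (\<lambda>y. affine_action (lin_ext (gen_bracket g) y) v)"
      by (rule clinear_compose[OF clinear_affine_action(2) clinear_lin_ext])
    show "clinear (\<lambda>y. gen_action g (affine_action y v) - affine_action y (gen_action g v))"
      by (intro cvp.linear_compose_sub clinear_affine_action(2)
          clinear_compose[OF clinear_gen_action clinear_affine_action(2)])
  qed (simp add: affine_action_gen affine_action_gen_bracket lin_ext_single)
  then show "affine_action (lie_bracket (gen g) y) v =
      affine_action (gen g) (affine_action y v) - affine_action y (affine_action (gen g) v)"
    by (simp add: lie_bracket_def lin_ext_single affine_action_gen)
qed

lemma affine_module_affine_action: "affine_module cscale affine_action"
  unfolding affine_module_def
  using vector_space_cscale clinear_affine_action affine_action_bracket by blast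

text \<open>These are the highest modes that do not kill the ket: the creation exponential
  contributes only its constant term. They connect neighbouring charges.\<close>

lemma e_mode_ket: "e_mode (- 1 - 2 * j) (ket j) = ket (j + 1)"
  and f_mode_ket: "f_mode (2 * j - 1) (ket j) = ket (j - 1)"
  by (simp_all add: e_mode_def f_mode_def vertex_mode_ket)

section \<open>Irreducibility\<close>

lemma affine_submoduleD:
  assumes U: "affine_submodule cscale affine_action U"
  shows "cv.subspace U"
    and "u \<in> U \<Longrightarrow> gen_action g u \<in> U"
    and "u \<in> U \<Longrightarrow> heis n u \<in> U"
proof -
  show sub: "cv.subspace U" using U by (simp add: affine_submodule_def)
  have inv: "gen_action g u \<in> U" if "u \<in> U" for g u
    using U that unfolding affine_submodule_def affine_invariant_def by (auto simp flip: affine_action_gen)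
  then show "u \<in> U \<Longrightarrow> gen_action g u \<in> U" .
  show "heis n u \<in> U" if "u \<in> U"
  proof -
    have "(1 / momc 1) *\<^sub>c gen_action (H n) u \<in> U"
      using inv[OF that] by (intro cv.subspace_scale[OF sub])
    then show ?thesis using momc_1(3) by (simp flip: momc_1(1))
  qed
qed

lemma submodule_UNIV_if_ket:
  assumes U: "affine_submodule cscale affine_action U" and ket: "ket j \<in> U"
  shows "U = UNIV"
proof -
  note sub = affine_submoduleD(1)[OF U] and inv = affine_submoduleD(2)[OF U] and heis = affine_submoduleD(3)[OF U]
  have kets: "ket i \<in> U" for i
  proof (induction i rule: int_induct[where k = j])
    case (step1 i)
    then show ?case using inv[of "ket i" "E (- 1 - 2 * i)"] by (simp add: e_mode_ket)
  next
    case (step2 i)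
    then show ?case using inv[of "ket i" "F (2 * i - 1)"] by (simp add: f_mode_ket)
  qed (rule ket)
  have "v \<in> U" for v
    by (induction v rule: fock_induct)
      (use kets heis cv.subspace_add[OF sub] cv.subspace_scale[OF sub] in auto)
  then show ?thesis by auto
qed

section \<open>Vectors of minimal support in a submodule\<close>

lemma lookup_heis_zero: "Poly_Mapping.lookup (heis 0 v) (j, M) = momc j * Poly_Mapping.lookup v (j, M)"
proof -
  have "Poly_Mapping.lookup v b * Poly_Mapping.lookup (heis_basis 0 b) (j, M) =
      (if b = (j, M) then momc j * Poly_Mapping.lookup v (j, M) else 0)" for b
    by (cases b) (auto simp: heis_basis_def lookup_single when_def momc_def)
  then show ?thesis
    by (simp add: heis_def lin_ext_def lookup_sum in_keys_iff)
qed

text \<open>Every monomial counts its degree plus one. The size thus drops both when degrees are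
  lowered and when a monomial, even one of degree 0, leaves the support.\<close>

definition support_size :: "lattice_va \<Rightarrow> nat"
  where "support_size v = (\<Sum>(j, M)\<in>Poly_Mapping.keys v. Suc (wt M))"

text \<open>Putting the removed entry back embeds the support of \<open>heis m v\<close> into that
  of \<open>v\<close> and strictly raises every degree.\<close>

lemma support_size_heis_pos:
  assumes "m > 0" "heis m v \<noteq> 0"
  shows "support_size (heis m v) < support_size v"
proof -
  define i where "i = nat (m - 1)"
  have m: "m = int i + 1" using assms(1) by (simp add: i_def)
  let ?h = "\<lambda>(j, M). (j :: int, add_mset i M)"
  have "support_size (heis m v) < (\<Sum>(j, M)\<in>Poly_Mapping.keys (heis m v). Suc (wt (add_mset i M)))"
    unfolding support_size_def using assms(2) by (intro sum_strict_mono) auto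
  also have "\<dots> = (\<Sum>(j, M)\<in>?h ` Poly_Mapping.keys (heis m v). Suc (wt M))"
    by (subst sum.reindex) (auto simp: inj_on_def intro!: sum.cong)
  also have "\<dots> \<le> support_size v"
    unfolding support_size_def
    by (rule sum_mono2) (auto simp: m in_keys_iff lookup_heis_pos)
  finally show ?thesis .
qed

lemma support_size_subset:
  "Poly_Mapping.keys w \<subset> Poly_Mapping.keys v \<Longrightarrow> support_size w < support_size v"
proof -
  assume sub: "Poly_Mapping.keys w \<subset> Poly_Mapping.keys v"
  then obtain b where "b \<in> Poly_Mapping.keys v - Poly_Mapping.keys w" by blast
  with sub show ?thesis
    unfolding support_size_def by (intro sum_strict_mono2[where b = b]) (auto split: prod.splits)
qed

lemma nonzero_submodule_ket:
  assumes U: "affine_submodule cscale affine_action U" and nz: "U \<noteq> {0}"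
  shows "\<exists>j. ket j \<in> U"
proof -
  note sub = affine_submoduleD(1)[OF U] and heis = affine_submoduleD(3)[OF U]
  obtain u0 where "u0 \<in> U" "u0 \<noteq> 0" using nz cv.subspace_0[OF sub] by auto
  then obtain u where u: "u \<in> U" "u \<noteq> 0"
    and min: "\<And>w. w \<in> U \<Longrightarrow> w \<noteq> 0 \<Longrightarrow> support_size u \<le> support_size w"
    using ex_has_least_nat[of "\<lambda>u. u \<in> U \<and> u \<noteq> 0" u0 support_size] by blast
  have primary: "heis m u = 0" if "m > 0" for m
    using min[OF heis[OF u(1)]] support_size_heis_pos[OF that, of u] by force
  obtain b where b: "b \<in> Poly_Mapping.keys u" using u(2) by (auto simp flip: keys_eq_empty)
  obtain j where bj: "b = (j, {#})" using b primary_keys[OF primary] by (cases b) auto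
  \<comment> \<open>Subtracting the eigenvalue of a_0 at \<open>b\<close> removes \<open>b\<close>
    from the support and adds nothing. By minimality \<open>w = 0\<close>, so only the charge
    \<open>j\<close> occurs in \<open>u\<close>.\<close>
  define w where "w = heis 0 u - momc j *\<^sub>c u"
  have lookup_w: "Poly_Mapping.lookup w (i, M) = (momc i - momc j) * Poly_Mapping.lookup u (i, M)" for i M
    by (simp add: w_def lookup_minus lookup_heis_zero algebra_simps)
  have "Poly_Mapping.keys w \<subseteq> Poly_Mapping.keys u" "b \<notin> Poly_Mapping.keys w"
    by (auto simp: bj in_keys_iff lookup_w)
  with b have "Poly_Mapping.keys w \<subset> Poly_Mapping.keys u" by blast
  moreover have "w \<in> U"
    unfolding w_def by (intro cv.subspace_diff[OF sub] heis cv.subspace_scale[OF sub] u(1))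
  ultimately have "w = 0" using min support_size_subset by (meson leD)
  have "M = {#} \<and> i = j" if "(i, M) \<in> Poly_Mapping.keys u" for i M
  proof -
    from that have "momc i = momc j"
      using lookup_w[of i M] by (simp add: \<open>w = 0\<close> in_keys_iff)
    then show ?thesis using that primary_keys[OF primary] by (auto simp: momc_def mom_def)
  qed
  then have eq: "u = Poly_Mapping.lookup u (j, {#}) *\<^sub>c ket j"
    by (intro poly_mapping_eqI) (force simp: ket_def lookup_single when_def in_keys_iff)
  have "Poly_Mapping.lookup u (j, {#}) \<noteq> 0" using b by (simp add: bj in_keys_iff)
  then have "ket j = (1 / Poly_Mapping.lookup u (j, {#})) *\<^sub>c u"
    by (subst (2) eq) simp
  then show ?thesis using cv.subspace_scale[OF sub u(1)] by metis
qed

lemma ket_nonzero: "ket j \<noteq> 0"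
  by (simp add: ket_def flip: keys_eq_empty)

lemma irreducible_affine_action: "irreducible_affine_module cscale affine_action"
proof -
  have "(UNIV :: lattice_va set) \<noteq> {0}" using ket_nonzero by blast
  then show ?thesis
    unfolding irreducible_affine_module_def
    using affine_module_affine_action nonzero_submodule_ket submodule_UNIV_if_ket by blast
qed

lemma n_plus_ket_0:
  assumes "x \<in> n_plus"
  shows "affine_action x (ket 0) = 0"
  using assms unfolding n_plus_def
proof (induction rule: cv.span_induct)
  case base
  show ?case
    by (rule cv.subspaceI)
      (simp_all add: clinear_affine_action(2)[THEN cvp.linear_0] clinear_affine_action(2)[THEN cvp.linear_add]
        clinear_affine_action(2)[THEN cvp.linear_scale])
next
  case (step x)
  then show ?case
    by (auto simp: affine_action_gen e_mode_def f_mode_def vertex_mode_ket heis_pos_ket)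
qed

lemma is_L_lattice_va: "is_L 0 1 cscale affine_action (ket 0)"
proof -
  have "cyclic_vector cscale affine_action (ket 0)"
    unfolding cyclic_vector_def using submodule_UNIV_if_ket by blast
  then show ?thesis
    unfolding is_L_def using irreducible_affine_action n_plus_ket_0
    by (simp add: affine_action_gen heis_zero_ket mom_def)
qed

section \<open>The space generated by the modes of e\<close>

lemma subspace_W_part: "cv.subspace (W_sqrt2_part j)"
  unfolding W_sqrt2_part_def by (rule cv.subspace_span)

lemma ket_W_part: "ket j \<in> W_sqrt2_part j"
  unfolding W_sqrt2_part_def by (rule cv.span_base) (auto intro: exI[of _ "[]"])

lemma e_mode_W_part:
  assumes "v \<in> W_sqrt2_part j"
  shows "e_mode n v \<in> W_sqrt2_part j"
  using assms unfolding W_sqrt2_part_def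
proof (induction rule: cv.span_induct)
  case base
  show ?case
    using cvp.linear_subspace_vimage[OF clinear_vertex_mode cv.subspace_span]
    by (simp add: vimage_def e_mode_def)
next
  case (step x)
  then obtain "is" where "x = foldr e_mode is (ket j)" by auto
  then show ?case by (intro cv.span_base) (auto intro: exI[of _ "n # is"])
qed

lemma W_part_antimono: "i \<le> j \<Longrightarrow> W_sqrt2_part j \<subseteq> W_sqrt2_part i"
proof (induction j rule: int_ge_induct)
  case (step j)
  have "foldr e_mode is (ket (j + 1)) \<in> W_sqrt2_part j" for "is"
    by (induction "is") (auto simp: e_mode_W_part e_mode_W_part[OF ket_W_part, of "- 1 - 2 * j" j, unfolded e_mode_ket])
  then have "W_sqrt2_part (j + 1) \<subseteq> W_sqrt2_part j"
    unfolding W_sqrt2_part_def[of "j + 1"] by (intro cv.span_minimal subspace_W_part) auto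
  with step show ?case by blast
qed simp

text \<open>The parts decrease as the charge grows, so any two vectors lie in the part with the
  smaller index.\<close>

lemma subspace_W: "cv.subspace W_sqrt2"
proof (rule cv.subspaceI)
  fix v w assume "v \<in> W_sqrt2" "w \<in> W_sqrt2"
  then obtain i j where "v \<in> W_sqrt2_part i" "w \<in> W_sqrt2_part j" by (auto simp: W_sqrt2_def)
  then have "v \<in> W_sqrt2_part (min i j)" "w \<in> W_sqrt2_part (min i j)"
    using W_part_antimono[of "min i j" i] W_part_antimono[of "min i j" j] by auto
  then show "v + w \<in> W_sqrt2"
    unfolding W_sqrt2_def using cv.subspace_add[OF subspace_W_part] by blast
next
  show "0 \<in> W_sqrt2" unfolding W_sqrt2_def using cv.subspace_0[OF subspace_W_part] by blast
  show "c *\<^sub>c v \<in> W_sqrt2" if "v \<in> W_sqrt2" for c v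
    using that unfolding W_sqrt2_def using cv.subspace_scale[OF subspace_W_part] by blast
qed

section \<open>Closure under the creation operators\<close>

lemma e_mode_W: "v \<in> W_sqrt2 \<Longrightarrow> e_mode n v \<in> W_sqrt2"
  using e_mode_W_part by (auto simp: W_sqrt2_def)

lemma ket_W: "ket j \<in> W_sqrt2"
  using ket_W_part by (auto simp: W_sqrt2_def)

lemma creation_exp_ket_W: "creation_exp 1 r (ket j) \<in> W_sqrt2"
proof -
  \<comment> \<open>The index n = 1 - r - 2j solves -n - 1 - 2(j - 1) = r, the order required by
    \<open>vertex_mode_ket\<close> at charge j - 1.\<close>
  have "creation_exp 1 r (ket j) = e_mode (1 - int r - 2 * j) (ket (j - 1))"
    by (simp add: e_mode_def vertex_mode_ket)
  then show ?thesis by (simp add: e_mode_W ket_W)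
qed

lemma heis_e_mode: "heis n (e_mode m v) = e_mode m (heis n v) + momc 1 *\<^sub>c e_mode (m + n) v"
  by (simp add: e_mode_def heis_vertex_mode)

text \<open>Moving a_n to the right through a product of e modes creates only further products of e
  modes, until a_n reaches the ket.\<close>

lemma heis_W_if_ket:
  assumes ket: "\<And>j. heis n (ket j) \<in> W_sqrt2" and v: "v \<in> W_sqrt2"
  shows "heis n v \<in> W_sqrt2"
proof -
  have "heis n (foldr e_mode is (ket j)) \<in> W_sqrt2" for "is" j
  proof (induction "is")
    case (Cons m "is")
    have "foldr e_mode is (ket j) \<in> W_sqrt2" by (induction "is") (auto simp: ket_W e_mode_W)
    then show ?case
      using Cons by (auto simp: heis_e_mode
          intro!: cv.subspace_add[OF subspace_W] cv.subspace_scale[OF subspace_W] e_mode_W)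
  qed (simp add: ket)
  moreover have "cv.subspace (heis n -` W_sqrt2)"
    by (rule cvp.linear_subspace_vimage[OF clinear_heis subspace_W])
  ultimately have "W_sqrt2_part j \<subseteq> heis n -` W_sqrt2" for j
    unfolding W_sqrt2_part_def by (intro cv.span_minimal) auto
  with v show ?thesis unfolding W_sqrt2_def by blast
qed

lemma heis_neg_W: "r > 0 \<Longrightarrow> v \<in> W_sqrt2 \<Longrightarrow> heis (- int r) v \<in> W_sqrt2"
proof (induction r arbitrary: v rule: less_induct)
  case (less r)
  show ?case
  proof (rule heis_W_if_ket)
    fix j
    let ?C = "\<lambda>r. creation_exp 1 r (ket j)"
    have S: "(\<Sum>m\<in>{1..<r}. heis (- int m) (?C (r - m))) \<in> W_sqrt2"
      using less by (intro cv.subspace_sum[OF subspace_W]) (auto simp: creation_exp_ket_W)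
    have "of_nat r *\<^sub>c ?C r = momc 1 *\<^sub>c (\<Sum>m=1..r. heis (- int m) (?C (r - m)))"
      by (rule creation_exp_rec)
    \<comment> \<open>The term \<open>m = r\<close> is a_{-r} on the ket itself, because the
      coefficient of order 0 is the identity. The induction hypothesis handles all other
      terms.\<close>
    also have "{1..r} = insert r {1..<r}" using less.prems by auto
    finally have "(1 / momc 1) *\<^sub>c of_nat r *\<^sub>c ?C r =
        heis (- int r) (ket j) + (\<Sum>m\<in>{1..<r}. heis (- int m) (?C (r - m)))"
      using momc_1(3) by simp
    then have "heis (- int r) (ket j) =
        (1 / momc 1) *\<^sub>c of_nat r *\<^sub>c ?C r - (\<Sum>m\<in>{1..<r}. heis (- int m) (?C (r - m)))"
      by (simp add: algebra_simps)
    also have "\<dots> \<in> W_sqrt2"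
      by (intro cv.subspace_diff[OF subspace_W] cv.subspace_scale[OF subspace_W] creation_exp_ket_W S)
    finally show "heis (- int r) (ket j) \<in> W_sqrt2" .
  qed (use less in simp)
qed

lemma W_eq_UNIV: "W_sqrt2 = UNIV"
proof -
  have "v \<in> W_sqrt2" for v
  proof (induction v rule: fock_induct)
    case (heis i v)
    have "- int i - 1 = - int (Suc i)" by simp
    with heis show ?case by (simp only: heis_neg_W zero_less_Suc)
  qed (use ket_W cv.subspace_add[OF subspace_W] cv.subspace_scale[OF subspace_W] in auto)
  then show ?thesis by auto
qed

text \<open>Invariance is read off from the equality with the whole space, which is proved directly
  through the creation operators.\<close>

theorem theorem3p1:
  shows "is_L 0 1 cscale affine_action (ket 0)
    \<and> affine_invariant affine_action W_sqrt2
    \<and> W_sqrt2 = UNIV"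
  using is_L_lattice_va by (simp add: W_eq_UNIV affine_invariant_def)

end
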